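(* Let $\mathcal{U}$ be the upper cluster algebra of the seed with mutable variables $a,b,c,d$, frozen variable $f$ (cluster $(a,b,c,d,f)$) and exchange matrix $$B=\begin{bmatrix}0&-1&1&-1\\1&0&-2&1\\-1&2&0&-1\\1&-1&1&0\\-1&0&0&1\end{bmatrix}.$$ Then $\mathcal{U}$ is generated over $\mathbb{Z}[f^{\pm1}]$ by $a,b,c,d$ and $$X=\frac{b^2+c^2+ad}{bc},\qquad Y=\frac{ad^2+ac^2+bcf+b^2d}{acd},\qquad Z=\frac{a^2d+ac^2+bcf+b^2d}{abd}.$$ The ideal of relations among these generators is generated by the elements $$bcX=b^2+c^2+ad,\qquad cY-bZ=d-a,$$ $$acX-adZ=ab-bd-cf,\qquad bdX-adY=cd-ac-bf,$$ $$bXZ-aX-bY-cZ=f.$$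
   Context: A seed (with $m$ mutable and $n-m$ frozen variables) is a pair $(\mathbf{x},B)$ where $\mathbf{x}=(x_1,\dots,x_n)$ freely generates a field $\mathcal{F}$ over $\mathbb{Q}$, and $B$ is an $n\times m$ integer matrix whose top $m\times m$ submatrix is skew-symmetric; $x_1,\dots,x_m$ are mutable and $x_{m+1},\dots,x_n$ are frozen. (Here $m=4$, $n=5$, and $(x_1,\dots,x_5)=(a,b,c,d,f)$.) For $1\le k\le m$ the mutation at $k$ is the seed $(\mathbf{x}',B')$ with $x_i'=x_i$ for $i\neq k$, $x_k'=\left(\prod_{B_{jk}>0}x_j^{B_{jk}}+\prod_{B_{jk}<0}x_j^{-B_{jk}}\right)x_k^{-1}$, and $B'_{ij}=-B_{ij}$ if $i=k$ or $j=k$, $B'_{ij}=B_{ij}+\frac{|B_{ik}|B_{kj}+B_{ik}|B_{kj}|}{2}$ otherwise. Mutation-equivalence is generated by mutations and by permutations of the indices preserving $\{1,\dots,m\}$ (acting simultaneously on $\mathbf{x}$ and the rows and columns of $B$). The clusters are the sets $\{z_1,\dots,z_n\}$ of variables (mutable and frozen) of seeds mutation-equivalent to the initial seed. The upper cluster algebra is $\mathcal{U}=\bigcap_{\text{clusters }\{z_1,\dots,z_n\}}\mathbb{Z}[z_1^{\pm1},\dots,z_n^{\pm1}]\subset\mathcal{F}$. The ideal of relations is the kernel of the surjection onto $\mathcal{U}$ from the polynomial ring over $\mathbb{Z}[f^{\pm1}]$ on symbols for the listed generators; an equation $P=Q$ stands for the element $P-Q$. *)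

theory Defs
  imports Complex_Main "HOL-Library.Poly_Mapping" "HOL-Combinatorics.Permutations"
begin

text \<open>Polynomials over \<open>'r\<close> in variables from \<open>'v\<close> are the finitely supported maps
  \<open>('v \<Rightarrow>\<^sub>0 nat) \<Rightarrow>\<^sub>0 'r\<close> with convolution product; Laurent polynomials over \<open>\<int>\<close> in
  one variable are \<open>int \<Rightarrow>\<^sub>0 int\<close>.\<close>

definition eval_mpoly ::
    "('r::zero \<Rightarrow> 'a::comm_ring_1) \<Rightarrow> ('v \<Rightarrow> 'a) \<Rightarrow> (('v \<Rightarrow>\<^sub>0 nat) \<Rightarrow>\<^sub>0 'r) \<Rightarrow> 'a" where
  "eval_mpoly h x p =
     (\<Sum>m\<in>Poly_Mapping.keys p. h (Poly_Mapping.lookup p m) *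
        (\<Prod>v\<in>Poly_Mapping.keys m. x v ^ Poly_Mapping.lookup m v))"

definition eval_laurent :: "'a::field \<Rightarrow> (int \<Rightarrow>\<^sub>0 int) \<Rightarrow> 'a" where
  "eval_laurent t p =
     (\<Sum>k\<in>Poly_Mapping.keys p. of_int (Poly_Mapping.lookup p k) * t powi k)"

inductive_set subring_gen :: "'a::ring_1 set \<Rightarrow> 'a set" for S :: "'a set" where
  base: "s \<in> S \<Longrightarrow> s \<in> subring_gen S"
| one: "1 \<in> subring_gen S"
| diff: "u \<in> subring_gen S \<Longrightarrow> v \<in> subring_gen S \<Longrightarrow> u - v \<in> subring_gen S"
| mult: "u \<in> subring_gen S \<Longrightarrow> v \<in> subring_gen S \<Longrightarrow> u * v \<in> subring_gen S"

inductive_set subfield_gen :: "'a::field set \<Rightarrow> 'a set" for S :: "'a set" where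
  base: "s \<in> S \<Longrightarrow> s \<in> subfield_gen S"
| one: "1 \<in> subfield_gen S"
| diff: "u \<in> subfield_gen S \<Longrightarrow> v \<in> subfield_gen S \<Longrightarrow> u - v \<in> subfield_gen S"
| mult: "u \<in> subfield_gen S \<Longrightarrow> v \<in> subfield_gen S \<Longrightarrow> u * v \<in> subfield_gen S"
| inverse: "u \<in> subfield_gen S \<Longrightarrow> inverse u \<in> subfield_gen S"

abbreviation ideal_gen :: "'a::comm_ring_1 set \<Rightarrow> 'a set" where
  "ideal_gen \<equiv> module.span (*)"

definition laurent_ring :: "'a::field set \<Rightarrow> 'a set" where
  "laurent_ring C = subring_gen (C \<union> inverse ` C)"

text \<open>The ambient field is the whole type \<open>'a\<close>; a subfield of a field of characteristic
  zero automatically contains \<open>\<rat>\<close>, so \<open>subfield_gen\<close> is generation over \<open>\<rat>\<close>.\<close>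

definition freely_generates :: "nat \<Rightarrow> (nat \<Rightarrow> 'a::field_char_0) \<Rightarrow> bool" where
  "freely_generates n x \<longleftrightarrow>
     (\<forall>p :: (nat \<Rightarrow>\<^sub>0 nat) \<Rightarrow>\<^sub>0 rat.
        (\<forall>m\<in>Poly_Mapping.keys p. Poly_Mapping.keys m \<subseteq> {..<n}) \<longrightarrow>
        eval_mpoly of_rat x p = 0 \<longrightarrow> p = 0) \<and>
     subfield_gen (x ` {..<n}) = UNIV"

text \<open>Indices are shifted to start at 0: the variables of a seed are \<open>x i\<close> with \<open>i < n\<close>,
  the mutable ones have \<open>i < m\<close>, and the \<open>n \<times> m\<close> exchange matrix has entries \<open>B i j\<close> with
  \<open>i < n\<close> and \<open>j < m\<close>. Values outside these ranges carry no meaning, and within the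
  ranges no construction below depends on them.\<close>

type_synonym 'a seed = "(nat \<Rightarrow> 'a) \<times> (nat \<Rightarrow> nat \<Rightarrow> int)"

definition is_seed :: "nat \<Rightarrow> nat \<Rightarrow> 'a::field_char_0 seed \<Rightarrow> bool" where
  "is_seed n m = (\<lambda>(x, B). m \<le> n \<and> freely_generates n x \<and> (\<forall>i<m. \<forall>j<m. B i j = - B j i))"

text \<open>The \<open>div 2\<close> is exact: \<open>\<bar>p\<bar> * q + p * \<bar>q\<bar>\<close> is always even.\<close>

definition mutate :: "nat \<Rightarrow> nat \<Rightarrow> 'a::field_char_0 seed \<Rightarrow> 'a seed" where
  "mutate n k = (\<lambda>(x, B).
     (x(k := ((\<Prod>j\<in>{j. j < n \<and> B j k > 0}. x j ^ nat (B j k)) +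
              (\<Prod>j\<in>{j. j < n \<and> B j k < 0}. x j ^ nat (- B j k))) * inverse (x k)),
      \<lambda>i j. if i = k \<or> j = k then - B i j
            else B i j + (\<bar>B i k\<bar> * B k j + B i k * \<bar>B k j\<bar>) div 2))"

definition permute_seed :: "(nat \<Rightarrow> nat) \<Rightarrow> 'a seed \<Rightarrow> 'a seed" where
  "permute_seed \<sigma> = (\<lambda>(x, B). (\<lambda>i. x (\<sigma> i), \<lambda>i j. B (\<sigma> i) (\<sigma> j)))"

definition seed_step :: "nat \<Rightarrow> nat \<Rightarrow> 'a::field_char_0 seed \<Rightarrow> 'a seed \<Rightarrow> bool" where
  "seed_step n m s t \<longleftrightarrow>
     (\<exists>k<m. t = mutate n k s) \<or>
     (\<exists>\<sigma>. \<sigma> permutes {..<n} \<and> \<sigma> ` {..<m} = {..<m} \<and> t = permute_seed \<sigma> s)"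

definition mutation_equivalent :: "nat \<Rightarrow> nat \<Rightarrow> 'a::field_char_0 seed \<Rightarrow> 'a seed \<Rightarrow> bool" where
  "mutation_equivalent n m = equivclp (seed_step n m)"

definition clusters :: "nat \<Rightarrow> nat \<Rightarrow> 'a::field_char_0 seed \<Rightarrow> 'a set set" where
  "clusters n m s = {fst t ` {..<n} | t. mutation_equivalent n m s t}"

definition upper_cluster_algebra :: "nat \<Rightarrow> nat \<Rightarrow> 'a::field_char_0 seed \<Rightarrow> 'a set" where
  "upper_cluster_algebra n m s = (\<Inter>C\<in>clusters n m s. laurent_ring C)"

datatype gen = Gen_a | Gen_b | Gen_c | Gen_d | Gen_X | Gen_Y | Gen_Z

text \<open>The polynomial ring over \<open>\<int>[f\<^sup>\<plusminus>\<^sup>1]\<close> on one symbol for each of the seven generators.\<close>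

type_synonym gen_poly = "(gen \<Rightarrow>\<^sub>0 nat) \<Rightarrow>\<^sub>0 (int \<Rightarrow>\<^sub>0 int)"

definition gen_var :: "gen \<Rightarrow> gen_poly" where
  "gen_var g = Poly_Mapping.single (Poly_Mapping.single g 1) 1"

definition frozen_const :: gen_poly where
  "frozen_const = Poly_Mapping.single 0 (Poly_Mapping.single 1 1)"

definition gen_relations :: "gen_poly set" where
  "gen_relations =
    (let a = gen_var Gen_a; b = gen_var Gen_b; c = gen_var Gen_c; d = gen_var Gen_d;
         X = gen_var Gen_X; Y = gen_var Gen_Y; Z = gen_var Gen_Z; f = frozen_const
     in {b * c * X - (b\<^sup>2 + c\<^sup>2 + a * d),
         (c * Y - b * Z) - (d - a),
         (a * c * X - a * d * Z) - (a * b - b * d - c * f),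
         (b * d * X - a * d * Y) - (c * d - a * c - b * f),
         (b * X * Z - a * X - b * Y - c * Z) - f})"

end

(* Relations 2 and 5 express d and f through a, b, c, X, Y, Z, and then relations 3 and 4 are
   redundant: the candidate ring R is the localisation at f of the hypersurface ring A generated by
   a, b, c, X, Y, Z with the single relation
   b c X = a^2 + b^2 + c^2 + a c Y - a b Z.

   Every mutation reproduces the exchange matrix up to a permutation of the indices, and the triple
   (X, Y, Z) of the mutated cluster generates the same R with it. As X, Y, Z are Laurent in their
   own cluster, R lies in every Laurent ring, that is, in the upper cluster algebra U.

   Conversely, each of a, b, c, d generates a prime ideal of R that contains none of the variables of
   the cluster mutated at it. If u is one of them, l lies in U and u l in R, then clearing
   denominators in that mutated cluster shows that u divides u l in R, so l lies in R; clearing the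
   denominators of an element of U in the initial cluster reduces to this step.

   Both the primality and the ideal of relations rest on Gauss's lemma for a linear factor m X - n. *)
theory Submission
  imports Defs "HOL-Computational_Algebra.Polynomial" "HOL-Library.Multiset"
begin

section \<open>Evaluation homomorphisms\<close>

text \<open>No quotient ring is formed. Reducing modulo \<open>u\<close> means reading the constant
  coefficient in \<open>K[u]\<close>, where \<open>K\<close> is the fraction field of a ring
  \<open>D\<close> generated by four of a, b, c, X, Y, Z. For \<open>u = a\<close> these four are b,
  c, Y, Z, and X depends on them and a through b c X = b^2 + c^2 + a d. For \<open>u = b\<close>
  they are a, c, X, Z, and Y is the dependent one, through a c Y = -(a^2 + c^2) + b (c X + a Z - b).
  At \<open>u = 0\<close> the dependent generator becomes a fraction n / m, and Gauss's lemma tells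
  which polynomials over \<open>D\<close> vanish there. Swapping a with d and b with c negates the
  exchange matrix and exchanges Y with Z, so everything about c and d follows from the computations
  for b and a. The ideal of relations lives in \<open>gen_poly\<close>, which is not given inside a
  field. For this reason Gauss's lemma has a homogenised root condition, and its coprimality
  hypothesis is pulled back from the field along the evaluation map.\<close>

definition is_ring_hom :: "('r::ring_1 \<Rightarrow> 's::ring_1) \<Rightarrow> bool" where
  "is_ring_hom h \<longleftrightarrow> h 1 = 1 \<and> (\<forall>x y. h (x - y) = h x - h y) \<and> (\<forall>x y. h (x * y) = h x * h y)"

lemma is_ring_homD:
  assumes "is_ring_hom h"
  shows "h 0 = 0" "h 1 = 1" "h (x - y) = h x - h y" "h (x * y) = h x * h y"
    "h (- x) = - h x" "h (x + y) = h x + h y"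
proof -
  have d: "h (x - y) = h x - h y" for x y using assms by (simp add: is_ring_hom_def)
  show z: "h 0 = 0" using d[of 0 0] by simp
  show "h 1 = 1" "h (x * y) = h x * h y" using assms by (simp_all add: is_ring_hom_def)
  show "h (x - y) = h x - h y" by (rule d)
  show m: "h (- x) = - h x" for x using d[of 0 x] z by simp
  show "h (x + y) = h x + h y" using d[of x "- y"] m[of y] by simp
qed

lemma is_ring_hom_power: "is_ring_hom h \<Longrightarrow> h (x ^ n) = h x ^ n"
  by (induction n) (simp_all add: is_ring_homD)

lemma is_ring_hom_of_int: "is_ring_hom (of_int :: int \<Rightarrow> 'a::ring_1)"
  by (simp add: is_ring_hom_def)

lemma is_ring_hom_of_rat: "is_ring_hom (of_rat :: rat \<Rightarrow> 'a::field_char_0)"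
  by (simp add: is_ring_hom_def of_rat_diff of_rat_mult)

lemma poly_mapping_sum_single:
  fixes p :: "'k \<Rightarrow>\<^sub>0 'r::comm_monoid_add"
  shows "(\<Sum>k\<in>Poly_Mapping.keys p. Poly_Mapping.single k (Poly_Mapping.lookup p k)) = p"
proof (rule poly_mapping_eqI)
  fix k
  have "Poly_Mapping.lookup (\<Sum>k\<in>Poly_Mapping.keys p. Poly_Mapping.single k (Poly_Mapping.lookup p k)) k
      = (\<Sum>j\<in>Poly_Mapping.keys p. if j = k then Poly_Mapping.lookup p j else 0)"
    unfolding lookup_sum by (rule sum.cong) (auto simp: lookup_single when_def)
  also have "\<dots> = Poly_Mapping.lookup p k"
    by (simp add: in_keys_iff)
  finally show "Poly_Mapping.lookup (\<Sum>k\<in>Poly_Mapping.keys p. Poly_Mapping.single k (Poly_Mapping.lookup p k)) k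
      = Poly_Mapping.lookup p k" .
qed

lemma poly_mapping_add_induct [case_names zero single add]:
  fixes p :: "'k \<Rightarrow>\<^sub>0 'r::comm_monoid_add"
  assumes "P 0" "\<And>k c. P (Poly_Mapping.single k c)" "\<And>p q. P p \<Longrightarrow> P q \<Longrightarrow> P (p + q)"
  shows "P p"
proof -
  have "P (\<Sum>k\<in>K. Poly_Mapping.single k (Poly_Mapping.lookup p k))" if "finite K" for K
    using that by (induction K rule: finite_induct) (auto intro: assms)
  from this[of "Poly_Mapping.keys p"] show ?thesis by (simp add: poly_mapping_sum_single)
qed

text \<open>A common form of \<open>eval_laurent\<close> and \<open>eval_mpoly\<close>:
  \<open>\<chi>\<close> is an integer power in the first case and the value of a monomial in the
  second. Multiplicativity is thus proved once, from that of \<open>\<chi>\<close>.\<close>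

definition mon_eval :: "('r::ring_1 \<Rightarrow> 'a::comm_ring_1) \<Rightarrow> ('k \<Rightarrow> 'a) \<Rightarrow> ('k \<Rightarrow>\<^sub>0 'r) \<Rightarrow> 'a" where
  "mon_eval h \<chi> p = (\<Sum>k\<in>Poly_Mapping.keys p. h (Poly_Mapping.lookup p k) * \<chi> k)"

lemma mon_eval_superset:
  assumes "is_ring_hom h" "finite K" "Poly_Mapping.keys p \<subseteq> K"
  shows "mon_eval h \<chi> p = (\<Sum>k\<in>K. h (Poly_Mapping.lookup p k) * \<chi> k)"
  unfolding mon_eval_def using assms
  by (intro sum.mono_neutral_left) (auto simp: in_keys_iff is_ring_homD)

lemma mon_eval_single:
  assumes "is_ring_hom h"
  shows "mon_eval h \<chi> (Poly_Mapping.single k c) = h c * \<chi> k"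
  by (subst mon_eval_superset[OF assms, of "{k}"]) auto

lemma mon_eval_zero: "mon_eval h \<chi> 0 = 0"
  by (simp add: mon_eval_def)

lemma mon_eval_add:
  assumes h: "is_ring_hom h"
  shows "mon_eval h \<chi> (p + q) = mon_eval h \<chi> p + mon_eval h \<chi> q"
proof -
  let ?K = "Poly_Mapping.keys p \<union> Poly_Mapping.keys q"
  have "Poly_Mapping.keys (p + q) \<subseteq> ?K" by (rule keys_add)
  then show ?thesis
    by (simp add: mon_eval_superset[OF h, of ?K] lookup_add is_ring_homD[OF h] distrib_right sum.distrib)
qed

lemma mon_eval_mult:
  assumes h: "is_ring_hom h" and \<chi>: "\<And>k l. \<chi> (k + l) = \<chi> k * \<chi> l"
  shows "mon_eval h \<chi> (p * q) = mon_eval h \<chi> p * mon_eval h \<chi> q"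
proof (induction p rule: poly_mapping_add_induct)
  case (single k c)
  show ?case
    by (induction q rule: poly_mapping_add_induct)
       (simp_all add: mon_eval_zero mon_eval_add[OF h] mult_single mon_eval_single[OF h]
          is_ring_homD[OF h] \<chi> algebra_simps)
qed (simp_all add: mon_eval_zero mon_eval_add[OF h] distrib_right)

lemma is_ring_hom_mon_eval:
  fixes h :: "'r::comm_ring_1 \<Rightarrow> 'a::comm_ring_1" and \<chi> :: "'k::comm_monoid_add \<Rightarrow> 'a"
  assumes h: "is_ring_hom h" and \<chi>0: "\<chi> 0 = 1" and \<chi>: "\<And>k l. \<chi> (k + l) = \<chi> k * \<chi> l"
  shows "is_ring_hom (mon_eval h \<chi>)"
proof -
  have "mon_eval h \<chi> 1 = 1"
    by (metis mon_eval_single[OF h] single_one \<chi>0 is_ring_homD(2)[OF h] mult_1)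
  moreover have "mon_eval h \<chi> (p - q) = mon_eval h \<chi> p - mon_eval h \<chi> q" for p q
    using mon_eval_add[OF h, of \<chi> "p - q" q] by simp
  ultimately show ?thesis
    using mon_eval_mult[of h \<chi>, OF h \<chi>] by (simp add: is_ring_hom_def)
qed

lemma eval_laurent_eq_mon_eval: "eval_laurent t = mon_eval of_int (\<lambda>k. t powi k)"
  by (simp add: fun_eq_iff eval_laurent_def mon_eval_def)

lemma is_ring_hom_eval_laurent: "t \<noteq> 0 \<Longrightarrow> is_ring_hom (eval_laurent t)"
  unfolding eval_laurent_eq_mon_eval
  by (rule is_ring_hom_mon_eval) (auto simp: is_ring_hom_of_int power_int_add)

definition mpoly_mon :: "('v \<Rightarrow> 'a::comm_ring_1) \<Rightarrow> ('v \<Rightarrow>\<^sub>0 nat) \<Rightarrow> 'a" where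
  "mpoly_mon x m = (\<Prod>v\<in>Poly_Mapping.keys m. x v ^ Poly_Mapping.lookup m v)"

lemma mpoly_mon_superset:
  assumes "finite V" "Poly_Mapping.keys m \<subseteq> V"
  shows "mpoly_mon x m = (\<Prod>v\<in>V. x v ^ Poly_Mapping.lookup m v)"
  unfolding mpoly_mon_def using assms
  by (intro prod.mono_neutral_left) (auto simp: in_keys_iff)

lemma mpoly_mon_zero: "mpoly_mon x 0 = 1"
  by (simp add: mpoly_mon_def)

lemma mpoly_mon_single: "mpoly_mon x (Poly_Mapping.single v n) = x v ^ n"
  by (subst mpoly_mon_superset[of "{v}"]) auto

lemma mpoly_mon_add: "mpoly_mon x (m + n) = mpoly_mon x m * mpoly_mon x n"
proof -
  let ?V = "Poly_Mapping.keys m \<union> Poly_Mapping.keys n"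
  have "Poly_Mapping.keys (m + n) \<subseteq> ?V" by (rule keys_add)
  then show ?thesis
    by (simp add: mpoly_mon_superset[of ?V] lookup_add power_add prod.distrib)
qed

lemma eval_mpoly_eq_mon_eval: "eval_mpoly h x = mon_eval h (mpoly_mon x)"
  by (simp add: fun_eq_iff eval_mpoly_def mon_eval_def mpoly_mon_def)

lemma is_ring_hom_eval_mpoly:
  fixes h :: "'r::comm_ring_1 \<Rightarrow> 'a::comm_ring_1"
  shows "is_ring_hom h \<Longrightarrow> is_ring_hom (eval_mpoly h x)"
  unfolding eval_mpoly_eq_mon_eval
  by (rule is_ring_hom_mon_eval) (auto simp: mpoly_mon_zero mpoly_mon_add)

lemma subring_gen_zero: "0 \<in> subring_gen S"
  using subring_gen.diff[OF subring_gen.one subring_gen.one] by simp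

lemma subring_gen_uminus: "x \<in> subring_gen S \<Longrightarrow> - x \<in> subring_gen S"
  using subring_gen.diff[OF subring_gen_zero] by fastforce

lemma subring_gen_add: "x \<in> subring_gen S \<Longrightarrow> y \<in> subring_gen S \<Longrightarrow> x + y \<in> subring_gen S"
  using subring_gen.diff[of x S "- y"] subring_gen_uminus[of y S] by simp

lemma subring_gen_power: "x \<in> subring_gen S \<Longrightarrow> x ^ n \<in> subring_gen S"
  by (induction n) (auto intro: subring_gen.intros)

lemma subring_gen_of_nat: "of_nat n \<in> subring_gen S"
  by (induction n) (auto intro: subring_gen_zero subring_gen.one subring_gen_add)

lemma subring_gen_of_int: "of_int k \<in> subring_gen S"
  by (cases k rule: int_cases2) (auto intro: subring_gen_of_nat subring_gen_uminus)

lemmas subring_gen_intros = subring_gen_zero subring_gen.one subring_gen_uminus subring_gen_add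
  subring_gen.diff subring_gen.mult subring_gen_power

lemma subring_gen_least:
  assumes "S \<subseteq> subring_gen T"
  shows "subring_gen S \<subseteq> subring_gen T"
proof
  fix x assume "x \<in> subring_gen S"
  then show "x \<in> subring_gen T"
    by induction (use assms in \<open>auto intro: subring_gen.intros\<close>)
qed

lemma subring_gen_mono: "S \<subseteq> T \<Longrightarrow> subring_gen S \<subseteq> subring_gen T"
  by (rule subring_gen_least) (auto intro: subring_gen.base)

lemma ring_hom_image_subring_gen:
  assumes h: "is_ring_hom h"
  shows "h ` subring_gen S = subring_gen (h ` S)"
proof
  have "h x \<in> subring_gen (h ` S)" if "x \<in> subring_gen S" for x
    using that by induction (auto simp: is_ring_homD[OF h] intro: subring_gen.intros)
  then show "h ` subring_gen S \<subseteq> subring_gen (h ` S)" by blast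
  have "\<exists>x\<in>subring_gen S. y = h x" if "y \<in> subring_gen (h ` S)" for y
    using that
  proof induction
    case one
    then show ?case using is_ring_homD(2)[OF h] subring_gen.one[of S] by force
  next
    case (diff u v)
    then obtain x y where "x \<in> subring_gen S" "u = h x" "y \<in> subring_gen S" "v = h y" by blast
    then show ?case
      by (intro bexI[of _ "x - y"]) (simp_all add: is_ring_homD(3)[OF h] subring_gen.diff)
  next
    case (mult u v)
    then obtain x y where "x \<in> subring_gen S" "u = h x" "y \<in> subring_gen S" "v = h y" by blast
    then show ?case
      by (intro bexI[of _ "x * y"]) (simp_all add: is_ring_homD(4)[OF h] subring_gen.mult)
  qed (auto intro: subring_gen.base)
  then show "subring_gen (h ` S) \<subseteq> h ` subring_gen S" by blast
qed

section \<open>Subrings, transcendence and algebraic independence\<close>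

definition is_subring :: "'a::ring_1 set \<Rightarrow> bool" where
  "is_subring D \<longleftrightarrow> 1 \<in> D \<and> (\<forall>x\<in>D. \<forall>y\<in>D. x - y \<in> D) \<and> (\<forall>x\<in>D. \<forall>y\<in>D. x * y \<in> D)"

lemma is_subringD:
  assumes "is_subring D"
  shows "0 \<in> D" "1 \<in> D" "x \<in> D \<Longrightarrow> y \<in> D \<Longrightarrow> x - y \<in> D" "x \<in> D \<Longrightarrow> y \<in> D \<Longrightarrow> x * y \<in> D"
    "x \<in> D \<Longrightarrow> - x \<in> D" "x \<in> D \<Longrightarrow> y \<in> D \<Longrightarrow> x + y \<in> D"
proof -
  have d: "x - y \<in> D" if "x \<in> D" "y \<in> D" for x y using that assms by (auto simp: is_subring_def)
  show o: "1 \<in> D" and "x \<in> D \<Longrightarrow> y \<in> D \<Longrightarrow> x * y \<in> D"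
    using assms by (auto simp: is_subring_def)
  show "x \<in> D \<Longrightarrow> y \<in> D \<Longrightarrow> x - y \<in> D" by (rule d)
  show z: "0 \<in> D" using d[OF o o] by simp
  show m: "x \<in> D \<Longrightarrow> - x \<in> D" for x using d[OF z, of x] by simp
  show "x \<in> D \<Longrightarrow> y \<in> D \<Longrightarrow> x + y \<in> D" using d[of x "- y"] m[of y] by simp
qed

lemma is_subring_power: "is_subring D \<Longrightarrow> x \<in> D \<Longrightarrow> x ^ n \<in> D"
  by (induction n) (auto intro: is_subringD)

lemma is_subring_sum: "is_subring D \<Longrightarrow> (\<And>i. i \<in> I \<Longrightarrow> g i \<in> D) \<Longrightarrow> sum g I \<in> D"
  by (induction I rule: infinite_finite_induct) (auto intro: is_subringD)

lemma is_subring_subring_gen: "is_subring (subring_gen S)"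
  by (auto simp: is_subring_def intro: subring_gen.intros)

lemma subring_gen_minimal:
  assumes "S \<subseteq> D" "is_subring D"
  shows "subring_gen S \<subseteq> D"
proof
  fix x assume "x \<in> subring_gen S"
  then show "x \<in> D"
    by induction (use assms in \<open>auto intro: is_subringD\<close>)
qed

section \<open>Polynomials over a subring \<open>D\<close> and the extension
  \<open>D[x]\<close>\<close>

definition poly_over :: "'a::comm_ring_1 set \<Rightarrow> 'a poly set" where
  "poly_over D = {p. \<forall>i. coeff p i \<in> D}"

lemma poly_overD: "p \<in> poly_over D \<Longrightarrow> coeff p i \<in> D"
  by (simp add: poly_over_def)

lemma poly_over_mono: "D \<subseteq> E \<Longrightarrow> poly_over D \<subseteq> poly_over E"
  by (auto simp: poly_over_def)

lemma poly_over_pCons_iff: "pCons c p \<in> poly_over D \<longleftrightarrow> c \<in> D \<and> p \<in> poly_over D"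
  by (fastforce simp: poly_over_def coeff_pCons split: nat.splits)

context
  fixes D :: "'a::comm_ring_1 set"
  assumes D: "is_subring D"
begin

lemma poly_over_0: "0 \<in> poly_over D"
  using D by (auto simp: poly_over_def intro: is_subringD)

lemma poly_over_const: "c \<in> D \<Longrightarrow> [:c:] \<in> poly_over D"
  by (simp add: poly_over_pCons_iff poly_over_0)

lemma poly_over_monom: "c \<in> D \<Longrightarrow> monom c n \<in> poly_over D"
  using D by (auto simp: poly_over_def intro: is_subringD)

lemma poly_over_add: "p \<in> poly_over D \<Longrightarrow> q \<in> poly_over D \<Longrightarrow> p + q \<in> poly_over D"
  using D by (auto simp: poly_over_def intro: is_subringD)

lemma poly_over_diff: "p \<in> poly_over D \<Longrightarrow> q \<in> poly_over D \<Longrightarrow> p - q \<in> poly_over D"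
  using D by (auto simp: poly_over_def intro: is_subringD)

lemma poly_over_mult: "p \<in> poly_over D \<Longrightarrow> q \<in> poly_over D \<Longrightarrow> p * q \<in> poly_over D"
  using D by (auto simp: poly_over_def coeff_mult intro!: is_subring_sum is_subringD(4))

lemma poly_over_smult: "c \<in> D \<Longrightarrow> p \<in> poly_over D \<Longrightarrow> smult c p \<in> poly_over D"
  using D by (auto simp: poly_over_def intro: is_subringD)

lemma poly_over_sum: "(\<And>i. i \<in> I \<Longrightarrow> g i \<in> poly_over D) \<Longrightarrow> sum g I \<in> poly_over D"
  by (induction I rule: infinite_finite_induct) (auto intro: poly_over_0 poly_over_add)

lemma poly_over_pcompose: "p \<in> poly_over D \<Longrightarrow> q \<in> poly_over D \<Longrightarrow> pcompose p q \<in> poly_over D"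
proof (induction p)
  case (pCons c p)
  then show ?case
    by (auto simp: pcompose_pCons poly_over_pCons_iff intro: poly_over_add poly_over_mult poly_over_const)
qed (simp add: poly_over_0)

end

definition adjoin :: "'a::comm_ring_1 set \<Rightarrow> 'a \<Rightarrow> 'a set" where
  "adjoin D x = {poly p x | p. p \<in> poly_over D}"

lemma adjoin_mono: "D \<subseteq> E \<Longrightarrow> adjoin D x \<subseteq> adjoin E x"
  using poly_over_mono[of D E] by (auto simp: adjoin_def)

context
  fixes D :: "'a::comm_ring_1 set"
  assumes D: "is_subring D"
begin

lemma is_subring_adjoin: "is_subring (adjoin D x)"
  unfolding is_subring_def adjoin_def
proof (intro conjI ballI)
  show "1 \<in> {poly p x |p. p \<in> poly_over D}"
    using poly_over_const[OF D, of 1] is_subringD(2)[OF D] by (intro CollectI exI[of _ "[:1:]"]) simp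
  fix y z assume "y \<in> {poly p x |p. p \<in> poly_over D}" "z \<in> {poly p x |p. p \<in> poly_over D}"
  then obtain p q where pq: "y = poly p x" "z = poly q x" "p \<in> poly_over D" "q \<in> poly_over D" by blast
  show "y - z \<in> {poly p x |p. p \<in> poly_over D}"
    using pq poly_over_diff[OF D] by (intro CollectI exI[of _ "p - q"]) simp
  show "y * z \<in> {poly p x |p. p \<in> poly_over D}"
    using pq poly_over_mult[OF D] by (intro CollectI exI[of _ "p * q"]) simp
qed

lemma adjoin_base: "c \<in> D \<Longrightarrow> c \<in> adjoin D x"
  unfolding adjoin_def by (intro CollectI exI[of _ "[:c:]"]) (simp add: poly_over_const[OF D])

lemma adjoin_var: "x \<in> adjoin D x"
  unfolding adjoin_def
  by (intro CollectI exI[of _ "[:0,1:]"])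
     (simp add: poly_over_pCons_iff poly_over_0[OF D] is_subringD[OF D])

text \<open>\<open>y0\<close> serves as the residue of \<open>y\<close> at \<open>x = 0\<close>.
  Together with \<open>transc_constant_term\<close>, which makes this residue well defined for
  transcendental \<open>x\<close>, it replaces the quotient ring modulo \<open>x\<close>.\<close>

lemma adjoin_decompose:
  assumes "y \<in> adjoin D x"
  obtains y0 y1 where "y0 \<in> D" "y1 \<in> adjoin D x" "y = y0 + x * y1"
proof -
  obtain p where p: "p \<in> poly_over D" "y = poly p x" using assms by (auto simp: adjoin_def)
  obtain c q where "p = pCons c q" by (cases p)
  with p show ?thesis by (intro that[of c "poly q x"]) (auto simp: adjoin_def poly_over_pCons_iff)
qed

end

lemma subring_gen_insert: "subring_gen (insert x S) = adjoin (subring_gen S) x"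
proof
  show "subring_gen (insert x S) \<subseteq> adjoin (subring_gen S) x"
    by (rule subring_gen_minimal)
       (auto intro: is_subring_adjoin is_subring_subring_gen adjoin_base adjoin_var subring_gen.base)
  have "poly p x \<in> subring_gen (insert x S)" if "p \<in> poly_over (subring_gen S)" for p
    using that
  proof (induction p)
    case (pCons c p)
    moreover have "c \<in> subring_gen (insert x S)"
      using pCons subring_gen_mono[of S "insert x S"] by (auto simp: poly_over_pCons_iff)
    ultimately show ?case
      by (auto simp: poly_over_pCons_iff intro: subring_gen.base subring_gen_intros)
  qed (simp add: subring_gen_zero)
  then show "adjoin (subring_gen S) x \<subseteq> subring_gen (insert x S)" by (auto simp: adjoin_def)
qed

section \<open>Transcendence over a subring\<close>

definition transc :: "'a::comm_ring_1 set \<Rightarrow> 'a \<Rightarrow> bool" where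
  "transc D x \<longleftrightarrow> (\<forall>p\<in>poly_over D. poly p x = 0 \<longrightarrow> p = 0)"

lemma transc_mono: "transc E x \<Longrightarrow> D \<subseteq> E \<Longrightarrow> transc D x"
  using poly_over_mono[of D E] by (auto simp: transc_def)

lemma transc_constant_term:
  assumes "transc D x" "y0 \<in> D" "y1 \<in> adjoin D x" "y0 + x * y1 = 0"
  shows "y0 = 0"
proof -
  obtain p where p: "p \<in> poly_over D" "y1 = poly p x" using assms by (auto simp: adjoin_def)
  then have "pCons y0 p \<in> poly_over D" "poly (pCons y0 p) x = 0"
    using assms by (simp_all add: poly_over_pCons_iff)
  then have "pCons y0 p = 0" using assms(1) by (auto simp: transc_def)
  then show ?thesis by simp
qed

text \<open>The test by which exchange polynomials and residues are later shown to be nonzero: it is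
  enough to isolate one transcendental element that occurs linearly.\<close>

lemma transc_linear_nonzero:
  assumes "transc D x" "is_subring D" "p \<in> D" "q \<in> D" "q \<noteq> 0"
  shows "p + q * x \<noteq> 0"
proof
  assume "p + q * x = 0"
  then have "poly [:p, q:] x = 0" by (simp add: mult.commute)
  moreover have "[:p, q:] \<in> poly_over D" using assms by (simp add: poly_over_pCons_iff poly_over_0)
  ultimately have "[:p, q:] = 0" using assms(1) by (auto simp: transc_def)
  then show False using assms(5) by simp
qed

lemma transc_nonzero: "transc D x \<Longrightarrow> is_subring D \<Longrightarrow> x \<noteq> 0" for x :: "'a::field"
  using transc_linear_nonzero[of D x 0 1] by (auto simp: is_subringD)

section \<open>Fractions of a subring, and transcendence under change of variable\<close>

definition fracs :: "'a::field set \<Rightarrow> 'a set" where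
  "fracs D = {p / q | p q. p \<in> D \<and> q \<in> D \<and> q \<noteq> 0}"

context
  fixes D :: "'a::field set"
  assumes D: "is_subring D"
begin

lemma fracsI: "p \<in> D \<Longrightarrow> q \<in> D \<Longrightarrow> q \<noteq> 0 \<Longrightarrow> p / q \<in> fracs D"
  by (auto simp: fracs_def)

lemma fracs_base: "p \<in> D \<Longrightarrow> p \<in> fracs D"
  using fracsI[of p 1] is_subringD[OF D] by simp

lemma is_subring_fracs: "is_subring (fracs D)"
  unfolding is_subring_def
proof (intro conjI ballI)
  show "1 \<in> fracs D" by (intro fracs_base is_subringD[OF D])
  fix x y assume "x \<in> fracs D" "y \<in> fracs D"
  then obtain p q r s where *: "x = p / q" "y = r / s" "p \<in> D" "q \<in> D" "r \<in> D" "s \<in> D" "q \<noteq> 0" "s \<noteq> 0"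
    by (auto simp: fracs_def)
  then have "x - y = (p * s - r * q) / (q * s)" "x * y = (p * r) / (q * s)" by (auto simp: diff_frac_eq)
  then show "x - y \<in> fracs D" "x * y \<in> fracs D"
    using * by (auto intro!: fracsI is_subringD[OF D])
qed

lemma fracs_divide: "x \<in> fracs D \<Longrightarrow> y \<in> fracs D \<Longrightarrow> x / y \<in> fracs D"
proof (cases "y = 0")
  case True
  then show ?thesis by (auto intro: fracs_base is_subringD[OF D])
next
  case False
  assume "x \<in> fracs D" "y \<in> fracs D"
  then obtain p q r s where *: "x = p / q" "y = r / s" "p \<in> D" "q \<in> D" "r \<in> D" "s \<in> D" "q \<noteq> 0" "s \<noteq> 0"
    by (auto simp: fracs_def)
  then have "x / y = (p * s) / (q * r)" "r \<noteq> 0" using False by auto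
  then show ?thesis using * by (auto intro!: fracsI is_subringD[OF D])
qed

lemma poly_over_fracs_clear:
  assumes "p \<in> poly_over (fracs D)"
  shows "\<exists>q\<in>D. q \<noteq> 0 \<and> smult q p \<in> poly_over D"
  using assms
proof (induction p)
  case 0
  show ?case using D by (intro bexI[of _ 1]) (auto intro: poly_over_0 is_subringD)
next
  case (pCons c p)
  then obtain q where q: "q \<in> D" "q \<noteq> 0" "smult q p \<in> poly_over D" by (auto simp: poly_over_pCons_iff)
  obtain r s where rs: "c = r / s" "r \<in> D" "s \<in> D" "s \<noteq> 0"
    using pCons.prems by (auto simp: poly_over_pCons_iff fracs_def)
  have "smult (s * q) (pCons c p) = pCons (q * r) (smult s (smult q p))" using rs by simp
  then show ?case
    using q rs D by (intro bexI[of _ "s * q"]) (auto simp: poly_over_pCons_iff intro: poly_over_smult is_subringD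
      simp del: smult_smult)
qed

lemma transc_fracs:
  assumes "transc D x"
  shows "transc (fracs D) x"
  unfolding transc_def
proof (intro ballI impI)
  fix p assume p: "p \<in> poly_over (fracs D)" "poly p x = 0"
  obtain q where q: "q \<in> D" "q \<noteq> 0" "smult q p \<in> poly_over D" using poly_over_fracs_clear[OF p(1)] by blast
  have "smult q p = 0" using assms q p(2) by (auto simp: transc_def simp del: smult_eq_0_iff)
  then show "p = 0" using q by simp
qed

text \<open>Composing a relation for \<open>\<alpha> * x + \<beta>\<close> with
  \<open>[:\<beta>, \<alpha>:]\<close> gives a relation for \<open>x\<close> over the fractions, and
  composition with a nonconstant polynomial loses nothing. This is how one coordinate of an
  independent family is exchanged for another.\<close>

lemma transc_affine:
  assumes "transc D x" "\<alpha> \<in> fracs D" "\<beta> \<in> fracs D" "\<alpha> \<noteq> 0"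
  shows "transc D (\<alpha> * x + \<beta>)"
  unfolding transc_def
proof (intro ballI impI)
  fix p assume p: "p \<in> poly_over D" "poly p (\<alpha> * x + \<beta>) = 0"
  have "p \<in> poly_over (fracs D)" using p poly_over_mono[of D "fracs D"] fracs_base by auto
  then have "pcompose p [:\<beta>, \<alpha>:] \<in> poly_over (fracs D)"
    using assms by (intro poly_over_pcompose is_subring_fracs)
      (auto simp: poly_over_pCons_iff intro: poly_over_0 is_subring_fracs)
  moreover have "poly (pcompose p [:\<beta>, \<alpha>:]) x = 0" using p(2) by (simp add: poly_pcompose algebra_simps)
  ultimately have "pcompose p [:\<beta>, \<alpha>:] = 0" using transc_fracs[OF assms(1)] by (auto simp: transc_def)
  then show "p = 0" using pcompose_eq_0[of p "[:\<beta>, \<alpha>:]"] assms(4) by simp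
qed

text \<open>The reversed polynomial of a relation for \<open>inverse x\<close> vanishes at
  \<open>x\<close>.\<close>

lemma transc_inverse:
  assumes "transc D x"
  shows "transc D (inverse x)"
  unfolding transc_def
proof (intro ballI impI)
  fix p assume p: "p \<in> poly_over D" "poly p (inverse x) = 0"
  have "reflect_poly p \<in> poly_over D"
    using p(1) is_subringD(1)[OF D] by (auto simp: poly_over_def coeff_reflect_poly)
  moreover have "poly (reflect_poly p) x = 0"
    using p(2) transc_nonzero[OF assms D] by (simp add: poly_reflect_poly_nz)
  ultimately have "reflect_poly p = 0" using assms by (auto simp: transc_def)
  then show "p = 0" by simp
qed

end

text \<open>A relation for \<open>y\<close> over \<open>D[x]\<close> is a double sum of terms in x^i
  y^j. Regrouped by powers of \<open>x\<close>, it has coefficients \<open>poly (h i) y\<close>.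
  These vanish because \<open>x\<close> is transcendental over \<open>D[y]\<close>, and then each
  \<open>h i\<close> vanishes because \<open>y\<close> is transcendental over
  \<open>D\<close>.\<close>

lemma transc_swap:
  fixes x y :: "'a::comm_ring_1"
  assumes y: "transc (subring_gen S) y" and x: "transc (subring_gen (insert y S)) x"
  shows "transc (subring_gen (insert x S)) y"
  unfolding transc_def
proof (intro ballI impI)
  let ?D = "subring_gen S"
  fix p assume p: "p \<in> poly_over (subring_gen (insert x S))" "poly p y = 0"
  have "\<exists>q\<in>poly_over ?D. coeff p j = poly q x" for j
    using poly_overD[OF p(1), of j] by (auto simp: subring_gen_insert adjoin_def)
  then obtain Q where Q: "\<And>j. Q j \<in> poly_over ?D" "\<And>j. coeff p j = poly (Q j) x" by metis
  define n where "n = degree p"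
  \<comment> \<open>A common bound for the degrees in \<open>x\<close>, so that the two summations
    can be interchanged.\<close>
  define M where "M = Max ((\<lambda>j. degree (Q j)) ` {..n})"
  have M: "degree (Q j) \<le> M" if "j \<le> n" for j unfolding M_def using that by (intro Max_ge) auto
  define h where "h i = (\<Sum>j\<le>n. monom (coeff (Q j) i) j)" for i
  have h: "h i \<in> poly_over ?D" for i
    unfolding h_def using Q(1) by (intro poly_over_sum poly_over_monom is_subring_subring_gen poly_overD)
  define R where "R = (\<Sum>i\<le>M. monom (poly (h i) y) i)"
  have "poly (h i) y \<in> subring_gen (insert y S)" for i
    using h by (auto simp: subring_gen_insert adjoin_def)
  then have "R \<in> poly_over (subring_gen (insert y S))"
    unfolding R_def by (intro poly_over_sum poly_over_monom is_subring_subring_gen)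
  moreover have "poly R x = 0"
  proof -
    have "poly R x = (\<Sum>i\<le>M. \<Sum>j\<le>n. coeff (Q j) i * y ^ j * x ^ i)"
      by (simp add: R_def h_def poly_sum poly_monom sum_distrib_right)
    also have "\<dots> = (\<Sum>j\<le>n. \<Sum>i\<le>M. coeff (Q j) i * y ^ j * x ^ i)" by (rule sum.swap)
    also have "\<dots> = (\<Sum>j\<le>n. poly (Q j) x * y ^ j)"
    proof (rule sum.cong)
      fix j assume "j \<in> {..n}"
      then have "poly (Q j) x = (\<Sum>i\<le>M. coeff (Q j) i * x ^ i)"
        using M[of j] unfolding poly_altdef
        by (intro sum.mono_neutral_left) (auto simp: coeff_eq_0)
      then show "(\<Sum>i\<le>M. coeff (Q j) i * y ^ j * x ^ i) = poly (Q j) x * y ^ j"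
        by (simp add: sum_distrib_left mult_ac)
    qed simp
    also have "\<dots> = poly p y" by (simp add: poly_altdef n_def Q(2))
    finally show ?thesis using p(2) by simp
  qed
  ultimately have "R = 0" using x by (auto simp: transc_def)
  have "poly (h i) y = 0" if "i \<le> M" for i
    using arg_cong[OF \<open>R = 0\<close>, of "\<lambda>r. coeff r i"] that by (simp add: R_def coeff_sum)
  then have hz: "h i = 0" if "i \<le> M" for i using y h that by (auto simp: transc_def)
  have "coeff (Q j) i = 0" if "j \<le> n" for i j
  proof (cases "i \<le> M")
    case True
    then show ?thesis
      using arg_cong[OF hz[OF True], of "\<lambda>r. coeff r j"] that by (simp add: h_def coeff_sum)
  next
    case False
    then show ?thesis using M[OF that] by (intro coeff_eq_0) simp
  qed
  then have "Q j = 0" if "j \<le> n" for j using that by (simp add: poly_eq_iff)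
  then have "coeff p n = 0" using Q(2)[of n] by simp
  then show "p = 0" by (simp add: n_def)
qed

text \<open>The recursive form makes the head the distinguished variable over the ring generated by
  the tail. \<open>alg_indep_mset\<close> removes the dependence on the order, so any entry can be
  brought to the head before it is exchanged or set to zero.\<close>

fun alg_indep :: "'a::comm_ring_1 list \<Rightarrow> bool" where
  "alg_indep [] \<longleftrightarrow> True"
| "alg_indep (x # xs) \<longleftrightarrow> transc (subring_gen (set xs)) x \<and> alg_indep xs"

lemma alg_indep_swap:
  assumes "alg_indep (x # y # xs)"
  shows "alg_indep (y # x # xs)"
proof -
  have "transc (subring_gen (set xs)) x"
    using assms transc_mono[OF _ subring_gen_mono[OF subset_insertI]] by auto
  then show ?thesis using assms transc_swap[of "set xs" y x] by simp
qed

text \<open>The head \<open>y\<close> of \<open>ys\<close> is first brought to the front of the tail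
  of \<open>xs\<close> by induction, and then swapped past the head of \<open>xs\<close>.\<close>

lemma alg_indep_mset:
  assumes "mset xs = mset ys" "alg_indep xs"
  shows "alg_indep ys"
  using assms
proof (induction "length xs" arbitrary: xs ys)
  case (Suc n)
  obtain x xs' where xs: "xs = x # xs'" using Suc(2) by (cases xs) auto
  obtain y ys' where ys: "ys = y # ys'" using Suc(3) xs by (cases ys) auto
  have n: "n = length xs'" "n = length ys'" using Suc(2) mset_eq_length[OF Suc(3)] by (auto simp: xs ys)
  show ?case
  proof (cases "x = y")
    case True
    then have m: "mset xs' = mset ys'" using Suc(3) by (simp add: xs ys)
    then have "set xs' = set ys'" by (metis set_mset_mset)
    then show ?thesis using Suc(1)[OF n(1) m] Suc(4) True by (simp add: xs ys)
  next
    case False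
    have "y \<in> set xs" using Suc(3) by (metis ys list.set_intros(1) set_mset_mset)
    then have "y \<in> set xs'" using False xs by simp
    define zs where "zs = remove1 y xs'"
    have m: "mset xs' = mset (y # zs)" using \<open>y \<in> set xs'\<close> by (simp add: zs_def)
    then have s: "set xs' = set (y # zs)" by (metis set_mset_mset)
    have "alg_indep (y # zs)" using Suc(1)[OF n(1) m] Suc(4) by (simp add: xs)
    then have "alg_indep (x # y # zs)" using Suc(4) s by (simp add: xs)
    then have a: "alg_indep (y # x # zs)" by (rule alg_indep_swap)
    have m': "mset (x # zs) = mset ys'" using Suc(3) m by (auto simp: xs ys)
    then have "set (x # zs) = set ys'" by (metis set_mset_mset)
    moreover have "alg_indep ys'"
      using Suc(1)[OF _ m'] a mset_eq_length[OF m'] n by simp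
    ultimately show ?thesis using a by (auto simp: ys)
  qed
qed simp

lemma alg_indep_affine:
  fixes x y :: "'a::field"
  assumes "alg_indep (x # xs)" "\<alpha> \<in> fracs (subring_gen (set xs))" "\<beta> \<in> fracs (subring_gen (set xs))"
    "\<alpha> \<noteq> 0" "y = \<alpha> * x + \<beta>"
  shows "alg_indep (y # xs)"
  using assms by (auto intro: transc_affine is_subring_subring_gen)

text \<open>Shaped for mutation: the new variable is an exchange polynomial \<open>e\<close> in the
  other variables divided by the old one, hence affine in \<open>inverse x\<close>.\<close>

lemma alg_indep_divide:
  fixes x e :: "'a::field"
  assumes "alg_indep (x # xs)" "e \<in> subring_gen (set xs)" "e \<noteq> 0"
  shows "alg_indep (e / x # xs)"
proof -
  have "alg_indep (inverse x # xs)"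
    using assms(1) by (auto intro: transc_inverse is_subring_subring_gen)
  then show ?thesis
    using alg_indep_affine[of "inverse x" xs e 0 "e / x"] assms(2,3)
      fracs_base[OF is_subring_subring_gen assms(2)]
      fracs_base[OF is_subring_subring_gen subring_gen_zero[of "set xs"]]
    by (simp add: field_class.field_divide_inverse del: alg_indep.simps)
qed

lemma alg_indep_nonzero:
  fixes xs :: "'a::field list"
  shows "alg_indep xs \<Longrightarrow> x \<in> set xs \<Longrightarrow> x \<noteq> 0"
proof (induction xs)
  case (Cons y ys)
  then show ?case using transc_nonzero[OF _ is_subring_subring_gen] by auto
qed simp

section \<open>Independence of cluster variables and divisibility\<close>

definition mpoly_vars :: "nat set \<Rightarrow> ((nat \<Rightarrow>\<^sub>0 nat) \<Rightarrow>\<^sub>0 'r::comm_ring_1) set" where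
  "mpoly_vars V = {P. \<forall>m\<in>Poly_Mapping.keys P. Poly_Mapping.keys m \<subseteq> V}"

lemma is_subring_mpoly_vars:
  "is_subring (mpoly_vars V :: ((nat \<Rightarrow>\<^sub>0 nat) \<Rightarrow>\<^sub>0 'r::comm_ring_1) set)"
  unfolding is_subring_def
proof (intro conjI ballI)
  fix P Q :: "(nat \<Rightarrow>\<^sub>0 nat) \<Rightarrow>\<^sub>0 'r"
  assume PQ: "P \<in> mpoly_vars V" "Q \<in> mpoly_vars V"
  have "Poly_Mapping.keys (P - Q) \<subseteq> Poly_Mapping.keys P \<union> Poly_Mapping.keys Q" by (rule keys_diff)
  then show "P - Q \<in> mpoly_vars V" using PQ by (fastforce simp: mpoly_vars_def)
  show "P * Q \<in> mpoly_vars V"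
    unfolding mpoly_vars_def
  proof (intro CollectI ballI)
    fix m assume "m \<in> Poly_Mapping.keys (P * Q)"
    then obtain k l where "m = k + l" "k \<in> Poly_Mapping.keys P" "l \<in> Poly_Mapping.keys Q"
      using keys_mult[of P Q] by blast
    then show "Poly_Mapping.keys m \<subseteq> V" using PQ keys_add[of k l] by (fastforce simp: mpoly_vars_def)
  qed
qed (simp add: mpoly_vars_def)

lemma mpoly_vars_single:
  "Poly_Mapping.keys m \<subseteq> V \<Longrightarrow> Poly_Mapping.single m c \<in> mpoly_vars V"
  by (simp add: mpoly_vars_def)

lemma lookup_mult_single:
  fixes P :: "('k::cancel_comm_monoid_add) \<Rightarrow>\<^sub>0 'r::comm_ring_1"
  shows "Poly_Mapping.lookup (P * Poly_Mapping.single l 1) k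
    = (\<Sum>m\<in>Poly_Mapping.keys P. if m + l = k then Poly_Mapping.lookup P m else 0)"
proof -
  have "P * Poly_Mapping.single l 1 = (\<Sum>m\<in>Poly_Mapping.keys P. Poly_Mapping.single (m + l) (Poly_Mapping.lookup P m))"
    by (subst (1) poly_mapping_sum_single[of P, symmetric]) (simp add: sum_distrib_right mult_single)
  then show ?thesis by (simp add: lookup_sum lookup_single when_def)
qed

text \<open>The coefficients of a relation for \<open>x k\<close> lift to polynomials
  \<open>P i\<close> in the first \<open>k\<close> variables. The lifted relation \<open>Q\<close>
  evaluates to zero, so it is zero by freeness, and its summands share no monomial, so every
  \<open>P i\<close> with \<open>i \<le> N\<close> is zero.\<close>

lemma freely_generates_transc:
  fixes x :: "nat \<Rightarrow> 'a::field_char_0"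
  assumes free: "freely_generates n x" and k: "k < n"
  shows "transc (subring_gen (x ` {..<k})) (x k)"
  unfolding transc_def
proof (intro ballI impI)
  let ?ev = "eval_mpoly of_rat x :: ((nat \<Rightarrow>\<^sub>0 nat) \<Rightarrow>\<^sub>0 rat) \<Rightarrow> 'a"
  have hom: "is_ring_hom ?ev" by (intro is_ring_hom_eval_mpoly is_ring_hom_of_rat)
  have var: "?ev (Poly_Mapping.single (Poly_Mapping.single i j) 1) = x i ^ j" for i j
    by (simp add: eval_mpoly_eq_mon_eval mon_eval_single is_ring_hom_of_rat mpoly_mon_single)
  fix p assume p: "p \<in> poly_over (subring_gen (x ` {..<k}))" "poly p (x k) = 0"
  have "subring_gen (x ` {..<k}) \<subseteq> ?ev ` mpoly_vars {..<k}"
  proof -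
    have "x ` {..<k} = ?ev ` ((\<lambda>i. Poly_Mapping.single (Poly_Mapping.single i 1) 1) ` {..<k})"
      by (simp add: image_image var)
    then have "subring_gen (x ` {..<k}) = ?ev ` subring_gen ((\<lambda>i. Poly_Mapping.single (Poly_Mapping.single i 1) 1) ` {..<k})"
      by (simp only: ring_hom_image_subring_gen[OF hom])
    moreover have "subring_gen ((\<lambda>i. Poly_Mapping.single (Poly_Mapping.single i 1) 1) ` {..<k}) \<subseteq> mpoly_vars {..<k}"
      by (intro subring_gen_minimal is_subring_mpoly_vars) (auto intro!: mpoly_vars_single)
    ultimately show ?thesis by (auto intro: image_mono)
  qed
  then have "\<exists>P\<in>mpoly_vars {..<k}. coeff p i = ?ev P" for i using poly_overD[OF p(1), of i] by blast
  then obtain P where P: "\<And>i. P i \<in> mpoly_vars {..<k}" "\<And>i. coeff p i = ?ev (P i)" by metis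
  define N where "N = degree p"
  define Q where "Q = (\<Sum>i\<le>N. P i * Poly_Mapping.single (Poly_Mapping.single k i) 1)"
  have "Q \<in> mpoly_vars {..<n}"
  proof -
    have "P i \<in> mpoly_vars {..<n}" for i using P(1)[of i] k by (fastforce simp: mpoly_vars_def)
    then show ?thesis unfolding Q_def using k
      by (intro is_subring_sum is_subringD(4) is_subring_mpoly_vars mpoly_vars_single) auto
  qed
  moreover have "?ev Q = 0"
  proof -
    have "?ev (\<Sum>i\<in>I. P i * Poly_Mapping.single (Poly_Mapping.single k i) 1) = (\<Sum>i\<in>I. coeff p i * x k ^ i)" if "finite I" for I
      using that by induction (simp_all add: is_ring_homD[OF hom] P(2) var)
    then show ?thesis using p(2) by (simp add: Q_def poly_altdef N_def)
  qed
  ultimately have "Q = 0" using free by (auto simp: freely_generates_def mpoly_vars_def)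
  have "P i = 0" if "i \<le> N" for i
  proof (rule poly_mapping_eqI)
    fix m
    show "Poly_Mapping.lookup (P i) m = Poly_Mapping.lookup 0 m"
    proof (cases "m \<in> Poly_Mapping.keys (P i)")
      case True
      have nk: "Poly_Mapping.lookup l k = 0" if "l \<in> Poly_Mapping.keys (P j)" for l j
        using P(1)[of j] that by (fastforce simp: mpoly_vars_def in_keys_iff)
      \<comment> \<open>The exponent of variable \<open>k\<close> in a monomial of \<open>Q\<close>
        identifies its summand, since that variable occurs in no \<open>P j\<close>.\<close>
      have eq: "l + Poly_Mapping.single k j = m + Poly_Mapping.single k i \<longleftrightarrow> l = m \<and> j = i"
        if "l \<in> Poly_Mapping.keys (P j)" for l j
      proof
        assume *: "l + Poly_Mapping.single k j = m + Poly_Mapping.single k i"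
        from arg_cong[OF *, of "\<lambda>r. Poly_Mapping.lookup r k"] have "j = i"
          using nk[OF that] nk[OF True] by (simp add: lookup_add)
        with * show "l = m \<and> j = i" by simp
      qed simp
      have "0 = Poly_Mapping.lookup Q (m + Poly_Mapping.single k i)" using \<open>Q = 0\<close> by simp
      also have "\<dots> = (\<Sum>j\<le>N. \<Sum>l\<in>Poly_Mapping.keys (P j). if l + Poly_Mapping.single k j = m + Poly_Mapping.single k i
          then Poly_Mapping.lookup (P j) l else 0)"
        by (simp add: Q_def lookup_sum lookup_mult_single)
      also have "\<dots> = (\<Sum>j\<le>N. if j = i then (\<Sum>l\<in>Poly_Mapping.keys (P i). if l = m then Poly_Mapping.lookup (P i) l else 0) else 0)"
        by (intro sum.cong) (auto simp: eq intro!: sum.cong sum.neutral)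
      also have "\<dots> = Poly_Mapping.lookup (P i) m" using that True by simp
      finally show ?thesis by simp
    qed (simp add: in_keys_iff)
  qed
  then have "coeff p N = 0" using P(2)[of N] by (simp add: is_ring_homD[OF hom])
  then show "p = 0" by (simp add: N_def)
qed

text \<open>The list is reversed because each variable is transcendental over the earlier ones,
  while \<open>alg_indep\<close> tests the head over the tail.\<close>

lemma freely_generates_alg_indep:
  fixes x :: "nat \<Rightarrow> 'a::field_char_0"
  assumes "freely_generates n x" "k \<le> n"
  shows "alg_indep (map x (rev [0..<k]))"
  using assms(2)
proof (induction k)
  case (Suc k)
  have "set (map x (rev [0..<k])) = x ` {..<k}" by auto
  then show ?case using Suc freely_generates_transc[OF assms(1), of k] by simp
qed simp

text \<open>This says that \<open>n\<close> is not a zero divisor on the quotient of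
  \<open>D\<close> by \<open>m D\<close>. If \<open>m\<close> generates a prime ideal, it amounts to
  \<open>n\<close> lying outside that ideal. The form with explicit multiples avoids the quotient,
  and only particular \<open>n\<close> are ever needed.\<close>

definition prime_to :: "'a::comm_ring_1 set \<Rightarrow> 'a \<Rightarrow> 'a \<Rightarrow> bool" where
  "prime_to D m n \<longleftrightarrow> (\<forall>y\<in>D. \<forall>z\<in>D. m * y = n * z \<longrightarrow> (\<exists>z'\<in>D. z = m * z'))"

lemma prime_to_power:
  assumes D: "is_subring D" "n \<in> D" and p: "prime_to D m n"
  shows "prime_to D m (n ^ k)"
proof (induction k)
  case 0
  show ?case by (auto simp: prime_to_def)
next
  case (Suc k)
  show ?case
    unfolding prime_to_def
  proof (intro ballI impI)
    fix y z assume "y \<in> D" "z \<in> D" "m * y = n ^ Suc k * z"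
    then have "m * y = n * (n ^ k * z)" "n ^ k * z \<in> D"
      using D by (auto simp: mult.assoc intro: is_subringD is_subring_power)
    then obtain y' where "y' \<in> D" "m * y' = n ^ k * z" using p \<open>y \<in> D\<close> unfolding prime_to_def by metis
    then show "\<exists>z'\<in>D. z = m * z'" using Suc \<open>z \<in> D\<close> unfolding prime_to_def by metis
  qed
qed

text \<open>Divide by \<open>m1\<close>, cancel it, and divide by \<open>m2\<close>.\<close>

lemma prime_to_mult:
  assumes D: "is_subring D" "m1 \<in> D" "m2 \<in> D" "n \<in> D"
    and p: "prime_to D m1 n" "prime_to D m2 n"
    and c: "\<And>z. z \<in> D \<Longrightarrow> m1 * z = 0 \<Longrightarrow> z = 0"
  shows "prime_to D (m1 * m2) n"
  unfolding prime_to_def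
proof (intro ballI impI)
  fix y z assume *: "y \<in> D" "z \<in> D" "m1 * m2 * y = n * z"
  then have "m1 * (m2 * y) = n * z" "m2 * y \<in> D" using D by (auto simp: mult.assoc intro: is_subringD)
  then obtain z1 where z1: "z1 \<in> D" "z = m1 * z1" using p(1) *(2) unfolding prime_to_def by metis
  have "m1 * (m2 * y - n * z1) = 0" using *(3) z1(2) by (simp add: algebra_simps)
  then have "m2 * y - n * z1 = 0" using c D * z1 by (meson is_subringD)
  then obtain z2 where "z2 \<in> D" "z1 = m2 * z2" using p(2) *(1) z1(1) unfolding prime_to_def
    by (metis eq_iff_diff_eq_0)
  then show "\<exists>z'\<in>D. z = m1 * m2 * z'" using z1 by (auto simp: mult.assoc)
qed

lemma prime_to_mult_right:
  assumes D: "is_subring D" "n2 \<in> D" and p: "prime_to D m n1" "prime_to D m n2"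
  shows "prime_to D m (n1 * n2)"
  unfolding prime_to_def
proof (intro ballI impI)
  fix y z assume *: "y \<in> D" "z \<in> D" "m * y = n1 * n2 * z"
  then obtain y' where "y' \<in> D" "n2 * z = m * y'"
    using p(1) is_subringD(4)[OF D] unfolding prime_to_def by (metis mult.assoc)
  then show "\<exists>z'\<in>D. z = m * z'" using p(2) *(2) unfolding prime_to_def by metis
qed

lemma prime_to_uminus:
  assumes D: "is_subring D" and p: "prime_to D m n"
  shows "prime_to D m (- n)"
  unfolding prime_to_def
proof (intro ballI impI)
  fix y z assume *: "y \<in> D" "z \<in> D" "m * y = - n * z"
  then have "m * (- y) = n * z" by simp
  then show "\<exists>z'\<in>D. z = m * z'" using p * is_subringD(5)[OF D] unfolding prime_to_def by metis
qed

text \<open>Gauss's lemma for a linear factor: \<open>homogeneous\<close> says that \<open>n / m\<close> is a root of \<open>p\<close>,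
  without assuming that the ring embeds into a field.\<close>

lemma linear_factor_over:
  assumes D: "is_subring D" "m \<in> D" "n \<in> D"
    and c: "\<And>z. z \<in> D \<Longrightarrow> m * z = 0 \<Longrightarrow> z = 0"
    and mn: "prime_to D m n"
    and p: "p \<in> poly_over D" "degree p \<le> N"
    and homogeneous: "(\<Sum>i\<le>N. coeff p i * n ^ i * m ^ (N - i)) = 0"
  shows "\<exists>q\<in>poly_over D. p = [:- n, m:] * q"
  using p homogeneous
proof (induction N arbitrary: p)
  case 0
  then obtain c where "p = [:c:]" by (auto elim: degree_eq_zeroE)
  with 0 have "p = 0" by simp
  then show ?case using poly_over_0[OF D(1)] by (intro bexI[of _ 0]) auto
next
  case (Suc N)
  define y where "y = (\<Sum>i\<le>N. coeff p i * n ^ i * m ^ (N - i))"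
  have H: "(\<Sum>i\<le>Suc N. coeff p i * n ^ i * m ^ (Suc N - i)) = m * y + n ^ Suc N * coeff p (Suc N)"
    unfolding y_def by (simp add: sum_distrib_left Suc_diff_le mult_ac)
  have yD: "- y \<in> D" and cD: "coeff p (Suc N) \<in> D" unfolding y_def using D Suc.prems(1)
    by (auto intro!: is_subringD is_subring_sum is_subring_power poly_overD)
  \<comment> \<open>Every other term of the homogeneous sum carries a factor \<open>m\<close>, so
    \<open>m\<close> divides \<open>n ^ Suc N\<close> times the top coefficient and therefore the
    top coefficient itself.\<close>
  have "m * (- y) = n ^ Suc N * coeff p (Suc N)"
    using trans[OF H[symmetric] Suc.prems(3)] by (simp add: add_eq_0_iff2 add.commute del: power_Suc)
  then obtain k where k: "k \<in> D" "coeff p (Suc N) = m * k"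
    using prime_to_power[OF D(1,3) mn, of "Suc N"] yD cD unfolding prime_to_def by metis
  \<comment> \<open>One step of long division by \<open>[:- n, m:]\<close>: the subtracted
    polynomial is \<open>[:- n, m:] * monom k N\<close>. The homogeneous sum of \<open>p'\<close> in
    degree \<open>N\<close>, multiplied by \<open>m\<close>, is that of \<open>p\<close> in degree
    \<open>Suc N\<close>.\<close>
  define p' where "p' = p - monom (- n * k) N - monom (m * k) (Suc N)"
  have p': "p' \<in> poly_over D"
    unfolding p'_def using D k Suc.prems(1)
    by (intro poly_over_diff poly_over_monom is_subringD(4,5)) auto
  have deg: "degree p' \<le> N"
  proof (rule degree_le, intro allI impI)
    fix i assume "N < i"
    then show "coeff p' i = 0"
      using k(2) Suc.prems(2) by (cases "i = Suc N") (auto simp: p'_def coeff_eq_0)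
  qed
  have "m * (\<Sum>i\<le>N. coeff p' i * n ^ i * m ^ (N - i)) = 0"
  proof -
    have "(\<Sum>i\<le>N. coeff p' i * n ^ i * m ^ (N - i)) = (\<Sum>i\<le>N. coeff p i * n ^ i * m ^ (N - i)
        + (if i = N then n * k * n ^ N else 0))"
      by (intro sum.cong) (auto simp: p'_def algebra_simps)
    also have "\<dots> = y + n * k * n ^ N" by (simp add: sum.distrib y_def)
    finally have "m * (\<Sum>i\<le>N. coeff p' i * n ^ i * m ^ (N - i)) = m * y + n ^ Suc N * coeff p (Suc N)"
      using k(2) by (simp add: algebra_simps)
    also have "\<dots> = 0" using H Suc.prems(3) by (rule trans[OF sym])
    finally show ?thesis .
  qed
  then have "(\<Sum>i\<le>N. coeff p' i * n ^ i * m ^ (N - i)) = 0"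
  proof (rule c[rotated])
    show "(\<Sum>i\<le>N. coeff p' i * n ^ i * m ^ (N - i)) \<in> D"
      using D p' by (auto intro!: is_subringD(4)[OF D(1)] is_subring_sum is_subring_power poly_overD)
  qed
  from Suc.IH[OF p' deg this] obtain q where q: "q \<in> poly_over D" "p' = [:- n, m:] * q" by blast
  have "monom (- n * k) N + monom (m * k) (Suc N) = [:- n, m:] * monom k N"
    by (simp add: smult_monom monom_Suc)
  moreover have "p = p' + (monom (- n * k) N + monom (m * k) (Suc N))" by (simp add: p'_def)
  ultimately have "p = [:- n, m:] * (q + monom k N)" by (simp only: q(2) distrib_left)
  then show ?case using q(1) k(1) D by (blast intro: poly_over_add poly_over_monom)
qed

lemma linear_factor_over_field:
  fixes D :: "'a::field set"
  assumes D: "is_subring D" "m \<in> D" "n \<in> D" "m \<noteq> 0" and mn: "prime_to D m n"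
    and p: "p \<in> poly_over D" "poly p (n / m) = 0"
  shows "\<exists>q\<in>poly_over D. p = [:- n, m:] * q"
proof (rule linear_factor_over[OF D(1-3) _ mn p(1) order_refl])
  have "(\<Sum>i\<le>degree p. coeff p i * n ^ i * m ^ (degree p - i)) = (\<Sum>i\<le>degree p. m ^ degree p * (coeff p i * (n / m) ^ i))"
    using D(4) by (intro sum.cong) (auto simp: power_diff power_divide)
  also have "\<dots> = m ^ degree p * poly p (n / m)" by (simp add: poly_altdef sum_distrib_left)
  finally show "(\<Sum>i\<le>degree p. coeff p i * n ^ i * m ^ (degree p - i)) = 0" using p(2) by simp
qed (use D in auto)

text \<open>Modulo \<open>v\<close> the ring \<open>D[v]\<close> becomes the domain
  \<open>D\<close>, in which \<open>n\<close> has the nonzero residue \<open>n0\<close>.\<close>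

lemma prime_to_variable:
  fixes D :: "'a::field set"
  assumes D: "is_subring D" and v: "transc D v"
    and n: "n0 \<in> D" "n0 \<noteq> 0" "n1 \<in> adjoin D v" "n = n0 + v * n1"
  shows "prime_to (adjoin D v) v n"
  unfolding prime_to_def
proof (intro ballI impI)
  fix y z assume y: "y \<in> adjoin D v" and z: "z \<in> adjoin D v" and eq: "v * y = n * z"
  obtain z0 z1 where z01: "z0 \<in> D" "z1 \<in> adjoin D v" "z = z0 + v * z1" using adjoin_decompose[OF D z] .
  have "n0 * z0 + v * (n0 * z1 + n1 * z - y) = 0" using eq z01(3) n(4) by (simp add: algebra_simps)
  moreover have "n0 * z1 + n1 * z - y \<in> adjoin D v"
    using is_subring_adjoin[OF D, of v] adjoin_base[OF D n(1)] n(3) z01(2) z y by (meson is_subringD)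
  ultimately have "n0 * z0 = 0" using transc_constant_term[OF v] is_subringD(4)[OF D n(1) z01(1)] by metis
  then show "\<exists>z'\<in>adjoin D v. z = v * z'" using n(2) z01 by auto
qed

text \<open>The ring \<open>adjoin (adjoin D T) u\<close> has the single relation \<open>m T = n + u e\<close>, and \<open>u\<close> generates a prime
  ideal of it: a product divisible by \<open>u\<close> is examined at \<open>u = 0\<close>, where \<open>T\<close> becomes \<open>n / m\<close>.\<close>

lemma prime_generator:
  fixes D :: "'a::field set" and T u :: 'a
  defines "A \<equiv> adjoin (adjoin D T) u" and "K \<equiv> fracs D"
  assumes D: "is_subring D" "m \<in> D" "n \<in> D" "m \<noteq> 0" and mn: "prime_to D m n"
    and u: "transc D u" and e: "e \<in> adjoin D u" and rel: "m * T = n + u * e"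
    and w: "w \<in> A" "w = w0 + u * w1" "w0 \<in> K" "w0 \<noteq> 0" "w1 \<in> adjoin K u"
  shows "prime_to A u w"
  unfolding prime_to_def
proof (intro ballI impI)
  fix s r assume s: "s \<in> A" and r: "r \<in> A" and "u * s = w * r"
  then have eq: "w * r = u * s" by simp
  note DT = is_subring_adjoin[OF D(1), of T]
  note A = is_subring_adjoin[OF DT, of u, folded A_def]
  have K: "is_subring K" unfolding K_def by (rule is_subring_fracs[OF D(1)])
  note Ku = is_subring_adjoin[OF K, of u]
  have DK: "D \<subseteq> K" unfolding K_def using fracs_base[OF D(1)] by blast
  have uK: "transc K u" unfolding K_def by (rule transc_fracs[OF D(1) u])
  have eA: "e \<in> A"
    using e adjoin_mono[of D "adjoin D T" u] adjoin_base[OF D(1)] by (auto simp: A_def)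
  have eK: "e \<in> adjoin K u" using e adjoin_mono[OF DK] by blast
  have miK: "inverse m \<in> K" using fracsI[OF D(1) is_subringD(2)[OF D(1)] D(2,4)] by (simp add: K_def inverse_eq_divide)
  define T1 where "T1 = e * inverse m"
  have T1: "T1 \<in> adjoin K u" unfolding T1_def using is_subringD(4)[OF Ku] eK adjoin_base[OF K miK] by blast
  have T: "T = n / m + u * T1" using rel D(4) by (simp add: T1_def field_simps)
  have T0: "n / m \<in> K" unfolding K_def using D by (auto intro: fracsI)
  have T0u: "n / m \<in> adjoin K u" and uu: "u \<in> adjoin K u" and w0u: "w0 \<in> adjoin K u"
    using T0 w(3) adjoin_base[OF K] adjoin_var[OF K] by auto
  have TK: "T \<in> adjoin K u"
    unfolding T by (intro is_subringD[OF Ku] T0u uu T1)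
  have polyK: "poly p x \<in> adjoin K u" if "p \<in> poly_over (adjoin K u)" "x \<in> adjoin K u" for p x
    using that(1)
  proof (induction p)
    case (pCons c p)
    then show ?case using is_subringD[OF Ku] that(2) by (auto simp: poly_over_pCons_iff)
  qed (simp add: is_subringD[OF Ku])
  \<comment> \<open>All of \<open>A\<close> lies in \<open>K[u]\<close>, where residues at
    \<open>u = 0\<close> make sense.\<close>
  have AK: "A \<subseteq> adjoin K u"
  proof -
    have "adjoin D T \<subseteq> adjoin K u"
      using polyK[OF _ TK] poly_over_mono[of D "adjoin K u"] DK adjoin_base[OF K] by (fastforce simp: adjoin_def[of D])
    then show ?thesis
      unfolding A_def using polyK[OF _ adjoin_var[OF K]] poly_over_mono[of "adjoin D T" "adjoin K u"]
      by (auto simp: adjoin_def[of "adjoin D T"])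
  qed
  obtain r0 r1 where r01: "r0 \<in> adjoin D T" "r1 \<in> A" "r = r0 + u * r1"
    using adjoin_decompose[OF DT r[unfolded A_def]] unfolding A_def by metis
  obtain p where p: "p \<in> poly_over D" "r0 = poly p T" using r01(1) by (auto simp: adjoin_def)
  \<comment> \<open>The residue of \<open>T\<close> is \<open>n / m\<close>, so that of
    \<open>poly p T\<close> is \<open>poly p (n / m)\<close>.\<close>
  have "\<exists>k\<in>adjoin K u. poly p T = poly p (n / m) + u * k \<and> poly p (n / m) \<in> K"
    using p(1)
  proof (induction p)
    case 0
    then show ?case using is_subringD(1)[OF Ku] is_subringD(1)[OF K] by (intro bexI[of _ 0]) auto
  next
    case (pCons c p)
    then obtain k where k: "k \<in> adjoin K u" "poly p T = poly p (n / m) + u * k" "poly p (n / m) \<in> K"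
      by (auto simp: poly_over_pCons_iff)
    have "poly (pCons c p) T = poly (pCons c p) (n / m) + u * (n / m * k + T1 * poly p T)"
      unfolding poly_pCons k(2) by (subst T) (simp add: algebra_simps)
    moreover have "n / m * k + T1 * poly p T \<in> adjoin K u"
      unfolding k(2) by (intro is_subringD[OF Ku] T0u uu T1 k(1) adjoin_base[OF K k(3)])
    moreover have "c \<in> K" using pCons.prems DK by (auto simp: poly_over_pCons_iff)
    then have "poly (pCons c p) (n / m) \<in> K" unfolding poly_pCons by (intro is_subringD[OF K] T0 k(3))
    ultimately show ?case by blast
  qed
  then obtain k where k: "k \<in> adjoin K u" "poly p T = poly p (n / m) + u * k" "poly p (n / m) \<in> K" by blast
  define r2 where "r2 = k + r1"
  have r2: "r2 \<in> adjoin K u" "r = poly p (n / m) + u * r2"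
    using r01 p(2) k AK by (auto simp: r2_def algebra_simps intro: is_subringD[OF Ku])
  \<comment> \<open>Compare residues in \<open>w * r = u * s\<close>: the right side has residue 0,
    and \<open>w0\<close> is a nonzero element of the field \<open>K\<close>.\<close>
  have "w0 * poly p (n / m) + u * (w0 * r2 + w1 * r - s) = 0"
    using eq by (simp add: w(2) r2(2) algebra_simps)
  moreover have "w0 * r2 + w1 * r - s \<in> adjoin K u"
    using r s AK by (intro is_subringD[OF Ku] w0u w(5) r2(1)) auto
  ultimately have "w0 * poly p (n / m) = 0"
    using transc_constant_term[OF uK] is_subringD(4)[OF K w(3) k(3)] by metis
  then have "poly p (n / m) = 0" using w(4) by simp
  then obtain q where q: "q \<in> poly_over D" "p = [:- n, m:] * q"
    using linear_factor_over_field[OF D mn p(1)] by blast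
  \<comment> \<open>At \<open>T\<close> the linear factor takes the value
    \<open>m * T - n = u * e\<close>, which supplies the factor \<open>u\<close>.\<close>
  have "r0 = (m * T - n) * poly q T" using p(2) q(2) by (simp add: algebra_simps)
  then have "r = u * (e * poly q T + r1)" unfolding r01(3) rel by (simp add: algebra_simps)
  moreover have "poly q T \<in> A" unfolding A_def using q(1) by (intro adjoin_base[OF DT]) (auto simp: adjoin_def)
  then have "e * poly q T + r1 \<in> A" using eA r01(2) by (intro is_subringD[OF A])
  ultimately show "\<exists>r'\<in>A. r = u * r'" by blast
qed

section \<open>The candidate ring\<close>

text \<open>Modulo \<open>v\<close> the sum of squares is \<open>w\<^sup>2\<close>, modulo
  \<open>w\<close> it is \<open>v\<^sup>2\<close>, and both are nonzero. This is the coprimality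
  required by Gauss's lemma for the relation of X (with b and c) and, up to sign, of Y (with a and
  c).\<close>

lemma prime_to_var_mult:
  fixes v w :: "'a::field"
  assumes "alg_indep (v # w # xs)"
  shows "prime_to (subring_gen (set (v # w # xs))) (v * w) (v\<^sup>2 + w\<^sup>2)"
proof -
  let ?D = "subring_gen (set (v # w # xs))"
  have nz: "v \<noteq> 0" "w \<noteq> 0" using assms alg_indep_nonzero[of "v # w # xs"] by auto
  have p: "prime_to (subring_gen (set (x # y # xs))) x (x\<^sup>2 + y\<^sup>2)"
    if a: "alg_indep (x # y # xs)" and "y \<noteq> 0" for x y
  proof -
    have "prime_to (adjoin (subring_gen (set (y # xs))) x) x (x\<^sup>2 + y\<^sup>2)"
      using a \<open>y \<noteq> 0\<close>
      by (intro prime_to_variable[where ?n0.0 = "y\<^sup>2" and ?n1.0 = x])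
        (auto simp: power2_eq_square subring_gen_insert[symmetric] is_subring_subring_gen intro!: subring_gen.mult intro: subring_gen.base)
    then show ?thesis by (simp add: subring_gen_insert)
  qed
  have "prime_to ?D w (w\<^sup>2 + v\<^sup>2)"
    using p[OF alg_indep_swap[OF assms] nz(1)] by (simp add: insert_commute)
  then show ?thesis
    using p[OF assms nz(2)] nz(1)
    by (intro prime_to_mult is_subring_subring_gen) (auto simp: add.commute intro!: subring_gen_intros intro: subring_gen.base)
qed

section \<open>Clearing denominators and cancelling a prime element\<close>

lemma clear_denominators:
  fixes R :: "'a::comm_ring_1 set"
  assumes R: "is_subring R" and P: "P \<in> R" "\<And>s. s \<in> S \<Longrightarrow> s \<in> R \<or> s * P \<in> R"
    and r: "r \<in> subring_gen S"
  shows "\<exists>N. r * P ^ N \<in> R"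
  using r
proof induction
  case (base s)
  then show ?case using P(2)[of s] by (metis mult.right_neutral power_0 power_one_right)
next
  case one
  show ?case using is_subringD(2)[OF R] by (intro exI[of _ 0]) simp
next
  case (diff u v)
  then obtain M N where MN: "u * P ^ M \<in> R" "v * P ^ N \<in> R" by blast
  have "u * P ^ M * P ^ N - v * P ^ N * P ^ M \<in> R"
    by (rule is_subringD(3)[OF R is_subringD(4)[OF R MN(1) is_subring_power[OF R P(1)]]
      is_subringD(4)[OF R MN(2) is_subring_power[OF R P(1)]]])
  then show ?case by (intro exI[of _ "M + N"]) (simp add: power_add left_diff_distrib mult_ac)
next
  case (mult u v)
  then obtain M N where "u * P ^ M \<in> R" "v * P ^ N \<in> R" by blast
  then have "(u * P ^ M) * (v * P ^ N) \<in> R" using is_subringD(4)[OF R] by blast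
  then show ?case by (intro exI[of _ "M + N"]) (simp add: power_add left_diff_distrib mult_ac)
qed

text \<open>In \<open>u * (l * P ^ N) = P ^ N * (u * l)\<close> both bracketed factors lie in
  \<open>R\<close>. As \<open>u\<close> is prime to \<open>P ^ N\<close>, it divides
  \<open>u * l\<close> within \<open>R\<close>.\<close>

lemma cancel_prime:
  fixes u :: "'a::field"
  assumes R: "is_subring R" "P \<in> R" and p: "prime_to R u P" and u: "u \<noteq> 0"
    and l: "u * l \<in> R" "l * P ^ N \<in> R"
  shows "l \<in> R"
proof -
  have "u * (l * P ^ N) = P ^ N * (u * l)" by simp
  then obtain z where "z \<in> R" "u * l = u * z"
    using prime_to_power[OF R p, of N] l unfolding prime_to_def by metis
  then show ?thesis using u by simp
qed

lemma laurent_cancel_prime: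
  fixes u :: "'a::field"
  assumes R: "is_subring R" and u: "u \<noteq> 0"
    and w: "\<And>w. w \<in> {p, q, r, s, t} \<Longrightarrow> w \<in> R" "\<And>w. w \<in> {p, q, r, s, t} \<Longrightarrow> prime_to R u w"
    and l: "l \<in> laurent_ring {p, q, r, s, t}" "u * l \<in> R"
  shows "l \<in> R"
proof -
  define P where "P = p * q * r * s * t"
  have wR: "p \<in> R" "q \<in> R" "r \<in> R" "s \<in> R" "t \<in> R" using w(1) by auto
  have inv: "inverse x * x \<in> R" for x :: 'a using is_subringD(1,2)[OF R] by (cases "x = 0") auto
  have PR: "P \<in> R" unfolding P_def by (intro is_subringD[OF R] wR)
  have "inverse x * P \<in> R" if x: "x \<in> {p, q, r, s, t}" for x
  proof -
    have "(inverse p * p) * q * r * s * t \<in> R" "p * (inverse q * q) * r * s * t \<in> R"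
      "p * q * (inverse r * r) * s * t \<in> R" "p * q * r * (inverse s * s) * t \<in> R"
      "p * q * r * s * (inverse t * t) \<in> R"
      by (rule is_subringD(4)[OF R] inv wR)+
    then show ?thesis using x unfolding P_def by (elim insertE emptyE) (simp_all only: mult_ac)
  qed
  then have "x \<in> R \<or> x * P \<in> R" if "x \<in> {p, q, r, s, t} \<union> inverse ` {p, q, r, s, t}" for x
    using that w(1) by blast
  then have "\<exists>N. l * P ^ N \<in> R"
    using l(1) unfolding laurent_ring_def by (rule clear_denominators[OF R PR])
  moreover have "prime_to R u P" unfolding P_def using w(2) by (intro prime_to_mult_right R wR) auto
  ultimately show ?thesis using cancel_prime[OF R PR _ u l(2)] by blast
qed

text \<open>The three extra generators are parameters together with the cluster, so that a mutated
  cluster is again an instance, with its own triple, and every fact below is available for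
  it.\<close>

locale cluster_tuple =
  fixes a b c d f X Y Z :: "'a::field_char_0"
  assumes indep: "alg_indep [a, b, c, d, f]"
    and X: "X = (b\<^sup>2 + c\<^sup>2 + a * d) / (b * c)"
    and Y: "Y = (a * d\<^sup>2 + a * c\<^sup>2 + b * c * f + b\<^sup>2 * d) / (a * c * d)"
    and Z: "Z = (a\<^sup>2 * d + a * c\<^sup>2 + b * c * f + b\<^sup>2 * d) / (a * b * d)"
begin

definition R :: "'a set" where
  "R = subring_gen {f, inverse f, a, b, c, d, X, Y, Z}"

lemma nonzero: "a \<noteq> 0" "b \<noteq> 0" "c \<noteq> 0" "d \<noteq> 0" "f \<noteq> 0"
  using alg_indep_nonzero[OF indep] by auto

lemma relX: "b * c * X = b\<^sup>2 + c\<^sup>2 + a * d"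
  using nonzero by (simp add: X)

lemma d_eq: "d = a + c * Y - b * Z"
proof -
  have "c * Y - b * Z = d - a"
    using nonzero by (simp add: Y Z field_simps power2_eq_square)
  then show ?thesis by (simp add: algebra_simps)
qed

text \<open>The exchange relation at \<open>a\<close> in polynomial form: \<open>a\<close> times
  \<open>b - c * X + d * Z\<close> is \<open>b * d + c * f\<close>. Likewise \<open>relY\<close>
  exhibits \<open>c - b * X + a * Y\<close> as the variable that replaces \<open>d\<close>.\<close>

lemma relZ: "a * c * X - a * d * Z = a * b - b * d - c * f"
  using nonzero by (simp add: X Z field_simps power2_eq_square)

lemma relY: "b * d * X - a * d * Y = c * d - a * c - b * f"
  using nonzero by (simp add: X Y field_simps power2_eq_square)

lemma f_eq: "f = b * X * Z - a * X - b * Y - c * Z"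
  using nonzero by (simp add: X Y Z field_simps power2_eq_square)

lemma relX': "b * c * X = a\<^sup>2 + b\<^sup>2 + c\<^sup>2 + a * c * Y - a * b * Z"
  using relX by (subst (asm) d_eq) (simp add: algebra_simps power2_eq_square)

text \<open>The permutation behind this negates the exchange matrix. That only interchanges the two
  monomials of each exchange polynomial, so the facts for \<open>c\<close> and \<open>d\<close> can
  be read off those for \<open>b\<close> and \<open>a\<close>.\<close>

lemma sym: "cluster_tuple d c b a f X Z Y"
proof
  have "mset [a, b, c, d, f] = mset [d, c, b, a, f]" by simp
  then show "alg_indep [d, c, b, a, f]" using alg_indep_mset indep by blast
qed (simp_all add: X Y Z algebra_simps)

text \<open>\<open>Z\<close> is affine in \<open>f\<close> with coefficient c / (a d), so it can
  take the place of \<open>f\<close> among the independent elements.\<close>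

lemma indep_abcdZ: "alg_indep [Z, a, b, c, d]"
proof -
  have i: "alg_indep [f, a, b, c, d]"
    using alg_indep_mset[OF _ indep, of "[f, a, b, c, d]"] by simp
  let ?K = "fracs (subring_gen {a, b, c, d})"
  note K = is_subring_fracs[OF is_subring_subring_gen, of "{a, b, c, d}"]
  note Kd = fracs_divide[OF is_subring_subring_gen, of _ "{a, b, c, d}"]
  have v: "a \<in> ?K" "b \<in> ?K" "c \<in> ?K" "d \<in> ?K"
    by (auto intro!: fracs_base is_subring_subring_gen subring_gen.base)
  show ?thesis
  proof (rule alg_indep_affine[OF i])
    show "Z = c / (a * d) * f + (a\<^sup>2 * d + a * c\<^sup>2 + b\<^sup>2 * d) / (a * b * d)"
      using nonzero by (simp add: Z field_simps power2_eq_square)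
    show "c / (a * d) \<in> fracs (subring_gen (set [a, b, c, d]))"
      "(a\<^sup>2 * d + a * c\<^sup>2 + b\<^sup>2 * d) / (a * b * d) \<in> fracs (subring_gen (set [a, b, c, d]))"
      unfolding power2_eq_square list.set by (intro Kd is_subringD[OF K] v)+
  qed (use nonzero in auto)
qed

text \<open>With \<open>Z\<close> kept as a coordinate, \<open>d_eq\<close> makes \<open>Y\<close>
  affine in \<open>d\<close>. These are the coordinates for setting \<open>a = 0\<close> and for the
  ideal of relations.\<close>

lemma indep_abcYZ: "alg_indep [Y, Z, a, b, c]"
proof -
  have i: "alg_indep [d, Z, a, b, c]"
    using alg_indep_mset[OF _ indep_abcdZ, of "[d, Z, a, b, c]"] by simp
  note K = is_subring_fracs[OF is_subring_subring_gen, of "{Z, a, b, c}"]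
  note Kd = fracs_divide[OF is_subring_subring_gen, of _ "{Z, a, b, c}"]
  let ?K = "fracs (subring_gen {Z, a, b, c})"
  have v: "a \<in> ?K" "b \<in> ?K" "c \<in> ?K" "Z \<in> ?K"
    by (auto intro!: fracs_base is_subring_subring_gen subring_gen.base)
  show ?thesis
  proof (rule alg_indep_affine[OF i])
    show "Y = 1 / c * d + (b * Z - a) / c"
      using nonzero by (subst d_eq) (simp add: field_simps)
    show "1 / c \<in> fracs (subring_gen (set [Z, a, b, c]))"
      "(b * Z - a) / c \<in> fracs (subring_gen (set [Z, a, b, c]))"
      unfolding list.set by (intro Kd is_subringD[OF K] v)+
  qed (use nonzero in auto)
qed

text \<open>A second system of coordinates, for setting \<open>b = 0\<close>: here \<open>d\<close>
  is exchanged for \<open>X\<close>.\<close>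

lemma indep_abcXZ: "alg_indep [X, Z, a, b, c]"
proof -
  have i: "alg_indep [d, Z, a, b, c]"
    using alg_indep_mset[OF _ indep_abcdZ, of "[d, Z, a, b, c]"] by simp
  note K = is_subring_fracs[OF is_subring_subring_gen, of "{Z, a, b, c}"]
  note Kd = fracs_divide[OF is_subring_subring_gen, of _ "{Z, a, b, c}"]
  let ?K = "fracs (subring_gen {Z, a, b, c})"
  have v: "a \<in> ?K" "b \<in> ?K" "c \<in> ?K" "Z \<in> ?K"
    by (auto intro!: fracs_base is_subring_subring_gen subring_gen.base)
  show ?thesis
  proof (rule alg_indep_affine[OF i])
    show "X = a / (b * c) * d + (b * b + c * c) / (b * c)"
      using nonzero by (simp add: X field_simps power2_eq_square)
    show "a / (b * c) \<in> fracs (subring_gen (set [Z, a, b, c]))"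
      "(b * b + c * c) / (b * c) \<in> fracs (subring_gen (set [Z, a, b, c]))"
      unfolding list.set by (intro Kd is_subringD[OF K] v)+
  qed (use nonzero in auto)
qed

definition A :: "'a set" where
  "A = subring_gen {a, b, c, X, Y, Z}"

lemma is_subring_R: "is_subring R"
  unfolding R_def by (rule is_subring_subring_gen)

lemma is_subring_A: "is_subring A"
  unfolding A_def by (rule is_subring_subring_gen)

lemma gens_in_A: "a \<in> A" "b \<in> A" "c \<in> A" "X \<in> A" "Y \<in> A" "Z \<in> A"
  by (auto simp: A_def intro: subring_gen.base)

lemma df_in_A: "d \<in> A" "f \<in> A"
proof -
  show "d \<in> A" by (subst d_eq) (intro is_subringD[OF is_subring_A] gens_in_A)
  show "f \<in> A" by (subst f_eq) (intro is_subringD[OF is_subring_A] gens_in_A)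
qed

lemma gens_in_R: "a \<in> R" "b \<in> R" "c \<in> R" "d \<in> R" "f \<in> R" "inverse f \<in> R" "X \<in> R" "Y \<in> R" "Z \<in> R"
  by (auto simp: R_def intro: subring_gen.base)

lemma A_subset_R: "A \<subseteq> R"
  unfolding A_def using gens_in_R by (intro subring_gen_minimal is_subring_R) auto

lemma R_clear:
  assumes "r \<in> R"
  shows "\<exists>N. r * f ^ N \<in> A"
proof (rule clear_denominators[OF is_subring_A df_in_A(2) _ assms[unfolded R_def]])
  have "inverse f * f \<in> A" using nonzero(5) is_subringD(2)[OF is_subring_A] by simp
  then show "s \<in> A \<or> s * f \<in> A" if "s \<in> {f, inverse f, a, b, c, d, X, Y, Z}" for s
    using that gens_in_A df_in_A by auto
qed

text \<open>A power \<open>f ^ (M + N)\<close> moves \<open>y\<close> and \<open>z\<close> into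
  \<open>A\<close>. The quotient found there is divided by the same power, which is a unit of
  \<open>R\<close>.\<close>

lemma prime_to_R:
  assumes p: "prime_to A u w"
  shows "prime_to R u w"
  unfolding prime_to_def
proof (intro ballI impI)
  fix y z assume yz: "y \<in> R" "z \<in> R" "u * y = w * z"
  obtain M N where MN: "y * f ^ M \<in> A" "z * f ^ N \<in> A" using R_clear yz by blast
  have fp: "f ^ k \<in> A" for k by (intro is_subring_power is_subring_A df_in_A)
  have "y * f ^ M * f ^ N \<in> A" "z * f ^ N * f ^ M \<in> A"
    using is_subringD(4)[OF is_subring_A MN(1) fp] is_subringD(4)[OF is_subring_A MN(2) fp] by auto
  moreover have "u * (y * f ^ M * f ^ N) = w * (z * f ^ N * f ^ M)"
  proof -
    have "u * (y * f ^ M * f ^ N) = (u * y) * f ^ M * f ^ N" by (simp only: mult.assoc)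
    then show ?thesis unfolding yz(3) by (simp only: mult_ac)
  qed
  ultimately obtain z' where z': "z' \<in> A" "z * f ^ N * f ^ M = u * z'" using p unfolding prime_to_def by blast
  have "z = u * (z' * inverse f ^ (N + M))" using z'(2) nonzero(5) by (simp add: power_add field_simps)
  moreover have "z' * inverse f ^ (N + M) \<in> R"
    using z'(1) A_subset_R by (intro is_subringD(4)[OF is_subring_R] is_subring_power is_subring_R gens_in_R) auto
  ultimately show "\<exists>z'\<in>R. z = u * z'" by blast
qed

text \<open>At \<open>a = 0\<close> one has X = (b^2 + c^2) / (b c) and d = c Y - b Z. Substituting
  this in \<open>w\<close> gives the residue \<open>w0\<close> passed to \<open>main\<close>, and
  the multiples of \<open>a\<close> form \<open>w1\<close>. The listed elements are the variables of
  the cluster mutated at \<open>a\<close>, the last by \<open>a'_eq\<close>.\<close>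

lemma prime_to_a:
  assumes "w \<in> {b, c, d, f, b - c * X + d * Z}"
  shows "prime_to R a w"
proof (rule prime_to_R)
  let ?D = "subring_gen {b, c, Y, Z}"
  let ?KU = "adjoin (fracs ?D) a"
  note D = is_subring_subring_gen[of "{b, c, Y, Z}"]
  note K = is_subring_fracs[OF D] and Kd = fracs_divide[OF D]
  note KU = is_subring_adjoin[OF K, of a]
  have gD: "b \<in> ?D" "c \<in> ?D" "Y \<in> ?D" "Z \<in> ?D" by (auto intro: subring_gen.base)
  note gK = fracs_base[OF D gD(1)] fracs_base[OF D gD(2)] fracs_base[OF D gD(3)] fracs_base[OF D gD(4)]
  have gKU: "b \<in> ?KU" "c \<in> ?KU" "Y \<in> ?KU" "Z \<in> ?KU" "a \<in> ?KU" "1 / b \<in> ?KU" "1 / c \<in> ?KU"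
    by (intro adjoin_base[OF K] adjoin_var[OF K] Kd gK is_subringD[OF K])+
  have dKU: "d \<in> ?KU" by (subst d_eq) (intro is_subringD[OF KU] gKU)
  have Xs: "X = b * (1 / c) + c * (1 / b) + a * d * (1 / b) * (1 / c)"
    using nonzero by (simp add: X field_simps power2_eq_square)
  have XKU: "X \<in> ?KU" by (subst Xs) (intro is_subringD[OF KU] gKU dKU)
  have A_eq: "A = adjoin (adjoin ?D X) a"
    unfolding A_def subring_gen_insert[symmetric] by (rule arg_cong[of _ _ subring_gen]) auto
  have i1: "alg_indep [a, b, c, Y, Z]" and i2: "alg_indep [b, c, Y, Z]" and i3: "alg_indep [Y, b, c, Z]"
    using alg_indep_mset[OF _ indep_abcYZ, of "[a, b, c, Y, Z]"]
      alg_indep_mset[OF _ indep_abcYZ, of "[a, Y, b, c, Z]"] by auto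
  have nzY: "p + q * Y \<noteq> 0" if "p \<in> subring_gen {b, c, Z}" "q \<in> subring_gen {b, c, Z}" "q \<noteq> 0" for p q
    using i3 that by (intro transc_linear_nonzero[OF _ is_subring_subring_gen]) auto
  have gS: "b \<in> subring_gen {b, c, Z}" "c \<in> subring_gen {b, c, Z}" "Z \<in> subring_gen {b, c, Z}"
    by (auto intro: subring_gen.base)
  have Znz: "Z \<noteq> 0" using alg_indep_nonzero[OF i1] by auto
  have main: "prime_to A a w" if "w = w0 + a * w1" "w0 \<in> fracs ?D" "w0 \<noteq> 0" "w1 \<in> ?KU" "w \<in> A" for w w0 w1
    unfolding A_eq
  proof (rule prime_generator[OF D, where m = "b * c" and n = "b\<^sup>2 + c\<^sup>2" and e = d and ?w0.0 = w0 and ?w1.0 = w1])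
    show "b * c \<in> ?D" "b\<^sup>2 + c\<^sup>2 \<in> ?D" unfolding power2_eq_square by (intro is_subringD[OF D] gD)+
    show "prime_to ?D (b * c) (b\<^sup>2 + c\<^sup>2)" using prime_to_var_mult[OF i2] by simp
    show "transc ?D a" using i1 by simp
    show "d \<in> adjoin ?D a"
      by (subst d_eq) (intro is_subringD[OF is_subring_adjoin[OF D]] adjoin_base[OF D] adjoin_var[OF D] gD)
    show "b * c * X = b\<^sup>2 + c\<^sup>2 + a * d" by (rule relX)
    show "w \<in> adjoin (adjoin ?D X) a" using that(5) by (simp only: A_eq)
  qed (use that nonzero in auto)
  have "prime_to A a b" by (rule main[of b b 0]) (use gK gens_in_A nonzero is_subringD(1)[OF KU] in auto)
  moreover have "prime_to A a c" by (rule main[of c c 0]) (use gK gens_in_A nonzero is_subringD(1)[OF KU] in auto)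
  moreover have "prime_to A a d"
  proof (rule main[of d "c * Y - b * Z" 1])
    show "d = c * Y - b * Z + a * 1" by (subst d_eq) simp
    show "c * Y - b * Z \<in> fracs ?D" by (intro is_subringD[OF K] gK)
    have "- (b * Z) + c * Y \<noteq> 0" using nonzero by (intro nzY is_subringD[OF is_subring_subring_gen] gS) auto
    then show "c * Y - b * Z \<noteq> 0" by simp
  qed (use df_in_A is_subringD(2)[OF KU] in auto)
  moreover have "prime_to A a f"
  proof (rule main[of f "b * b * Z / c - b * Y" "d * Z * (1 / c) - X"])
    have "b * X * Z = b * b * Z / c + c * Z + a * (d * Z * (1 / c))"
      using nonzero by (simp add: X field_simps power2_eq_square)
    then show "f = b * b * Z / c - b * Y + a * (d * Z * (1 / c) - X)"
      unfolding f_eq right_diff_distrib by simp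
    show "b * b * Z / c - b * Y \<in> fracs ?D" by (intro is_subringD[OF K] Kd gK)
    have "b * b * Z + (- (b * c)) * Y \<noteq> 0"
      using nonzero by (intro nzY is_subringD[OF is_subring_subring_gen] gS) auto
    then show "b * b * Z / c - b * Y \<noteq> 0" using nonzero by (simp add: field_simps)
    show "d * Z * (1 / c) - X \<in> ?KU" by (intro is_subringD[OF KU] gKU dKU XKU)
  qed (use df_in_A in auto)
  moreover have "prime_to A a (b - c * X + d * Z)"
  proof (rule main[of "b - c * X + d * Z" "(c * Y - b * Z) * Z - c * c / b" "Z - d * (1 / b)"])
    have cX: "c * X = b + c * c / b + a * (d * (1 / b))"
      using nonzero by (simp add: X field_simps power2_eq_square)
    have dZ: "d * Z = (c * Y - b * Z) * Z + a * Z" by (subst d_eq) (simp add: algebra_simps)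
    show "b - c * X + d * Z = (c * Y - b * Z) * Z - c * c / b + a * (Z - d * (1 / b))"
      unfolding cX dZ right_diff_distrib by simp
    show "(c * Y - b * Z) * Z - c * c / b \<in> fracs ?D" by (intro is_subringD[OF K] Kd gK)
    \<comment> \<open>\<open>b\<close> times the residue, arranged as a linear polynomial in
      \<open>Y\<close>.\<close>
    have "(- (b * b * Z * Z) - c * c) + (b * c * Z) * Y \<noteq> 0"
      using nonzero Znz by (intro nzY is_subringD[OF is_subring_subring_gen] gS) auto
    then show "(c * Y - b * Z) * Z - c * c / b \<noteq> 0" using nonzero by (simp add: field_simps)
    show "Z - d * (1 / b) \<in> ?KU" by (intro is_subringD[OF KU] gKU dKU)
    show "b - c * X + d * Z \<in> A" by (intro is_subringD[OF is_subring_A] gens_in_A df_in_A)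
  qed
  ultimately show "prime_to A a w" using assms by auto
qed

text \<open>The relation for \<open>X\<close> is useless here, because its coefficient b c vanishes
  at \<open>b = 0\<close>; the one for \<open>Y\<close> has coefficient a c. At \<open>b = 0\<close>
  it gives Y = -(a^2 + c^2) / (a c), hence d = a + c Y = -c^2 / a and f = -(a X + c Z).\<close>

lemma prime_to_b:
  assumes "w \<in> {a, c, d, f, c * X - b}"
  shows "prime_to R b w"
proof (rule prime_to_R)
  let ?D = "subring_gen {a, c, X, Z}"
  let ?KU = "adjoin (fracs ?D) b"
  note D = is_subring_subring_gen[of "{a, c, X, Z}"]
  note K = is_subring_fracs[OF D] and Kd = fracs_divide[OF D]
  note KU = is_subring_adjoin[OF K, of b]
  have gD: "a \<in> ?D" "c \<in> ?D" "X \<in> ?D" "Z \<in> ?D" by (auto intro: subring_gen.base)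
  note gK = fracs_base[OF D gD(1)] fracs_base[OF D gD(2)] fracs_base[OF D gD(3)] fracs_base[OF D gD(4)]
  have gKU: "a \<in> ?KU" "c \<in> ?KU" "X \<in> ?KU" "Z \<in> ?KU" "b \<in> ?KU" "1 / a \<in> ?KU" "1 / c \<in> ?KU"
    by (intro adjoin_base[OF K] adjoin_var[OF K] Kd gK is_subringD[OF K])+
  have rel: "a * c * Y = - (a\<^sup>2 + c\<^sup>2) + b * (c * X + a * Z - b)"
    using relX' by (simp add: algebra_simps power2_eq_square)
  have Ys: "Y = - (a * (1 / c)) - c * (1 / a) + b * (c * X + a * Z - b) * (1 / a) * (1 / c)"
  proof -
    have "Y = (- (a\<^sup>2 + c\<^sup>2) + b * (c * X + a * Z - b)) / (a * c)" using rel nonzero by (simp add: eq_divide_eq mult.commute)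
    then show ?thesis using nonzero by (simp add: add_divide_distrib diff_divide_distrib power2_eq_square)
  qed
  have YKU: "Y \<in> ?KU" by (subst Ys) (intro is_subringD[OF KU] gKU)
  have A_eq: "A = adjoin (adjoin ?D Y) b"
    unfolding A_def subring_gen_insert[symmetric] by (rule arg_cong[of _ _ subring_gen]) auto
  have i1: "alg_indep [b, a, c, X, Z]" and i2: "alg_indep [a, c, X, Z]" and i3: "alg_indep [X, a, c, Z]"
    using alg_indep_mset[OF _ indep_abcXZ, of "[b, a, c, X, Z]"]
      alg_indep_mset[OF _ indep_abcXZ, of "[b, X, a, c, Z]"] by auto
  have nzX: "p + q * X \<noteq> 0" if "p \<in> subring_gen {a, c, Z}" "q \<in> subring_gen {a, c, Z}" "q \<noteq> 0" for p q
    using i3 that by (intro transc_linear_nonzero[OF _ is_subring_subring_gen]) auto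
  have gS: "a \<in> subring_gen {a, c, Z}" "c \<in> subring_gen {a, c, Z}" "Z \<in> subring_gen {a, c, Z}"
    by (auto intro: subring_gen.base)
  have Xnz: "X \<noteq> 0" using alg_indep_nonzero[OF i1] by auto
  have main: "prime_to A b w" if "w = w0 + b * w1" "w0 \<in> fracs ?D" "w0 \<noteq> 0" "w1 \<in> ?KU" "w \<in> A" for w w0 w1
    unfolding A_eq
  proof (rule prime_generator[OF D, where m = "a * c" and n = "- (a\<^sup>2 + c\<^sup>2)" and e = "c * X + a * Z - b" and ?w0.0 = w0 and ?w1.0 = w1])
    show "a * c \<in> ?D" "- (a\<^sup>2 + c\<^sup>2) \<in> ?D" unfolding power2_eq_square by (intro is_subringD[OF D] gD)+
    show "prime_to ?D (a * c) (- (a\<^sup>2 + c\<^sup>2))"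
      using prime_to_var_mult[OF i2] by (intro prime_to_uminus D) simp
    show "transc ?D b" using i1 by simp
    show "c * X + a * Z - b \<in> adjoin ?D b"
      by (intro is_subringD[OF is_subring_adjoin[OF D]] adjoin_base[OF D] adjoin_var[OF D] gD)
    show "a * c * Y = - (a\<^sup>2 + c\<^sup>2) + b * (c * X + a * Z - b)" by (rule rel)
    show "w \<in> adjoin (adjoin ?D Y) b" using that(5) by (simp only: A_eq)
  qed (use that nonzero in auto)
  have "prime_to A b a" by (rule main[of a a 0]) (use gK gens_in_A nonzero is_subringD(1)[OF KU] in auto)
  moreover have "prime_to A b c" by (rule main[of c c 0]) (use gK gens_in_A nonzero is_subringD(1)[OF KU] in auto)
  moreover have "prime_to A b d"
  proof (rule main[of d "- (c * c / a)" "(c * X - b) * (1 / a)"])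
    show "d = - (c * c / a) + b * ((c * X - b) * (1 / a))"
      using relX nonzero by (simp add: field_simps power2_eq_square)
    show "- (c * c / a) \<in> fracs ?D" by (intro is_subringD[OF K] Kd gK)
    show "(c * X - b) * (1 / a) \<in> ?KU" by (intro is_subringD[OF KU] gKU)
  qed (use df_in_A nonzero in auto)
  moreover have "prime_to A b f"
  proof (rule main[of f "- (c * Z) - a * X" "X * Z - Y"])
    show "f = - (c * Z) - a * X + b * (X * Z - Y)" by (subst f_eq) (simp add: algebra_simps)
    show "- (c * Z) - a * X \<in> fracs ?D" by (intro is_subringD[OF K] gK)
    have "- (c * Z) + (- a) * X \<noteq> 0" using nonzero by (intro nzX is_subringD[OF is_subring_subring_gen] gS) auto
    then show "- (c * Z) - a * X \<noteq> 0" by simp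
    show "X * Z - Y \<in> ?KU" by (intro is_subringD[OF KU] gKU YKU)
  qed (use df_in_A in auto)
  moreover have "prime_to A b (c * X - b)"
  proof (rule main[of "c * X - b" "c * X" "- 1"])
    show "c * X \<in> fracs ?D" by (intro is_subringD[OF K] gK)
    show "- 1 \<in> ?KU" by (intro is_subringD[OF KU])
    show "c * X - b \<in> A" by (intro is_subringD[OF is_subring_A] gens_in_A df_in_A)
  qed (use nonzero Xnz in auto)
  ultimately show "prime_to A b w" using assms by auto
qed

lemma b'_eq: "(c\<^sup>2 + a * d) / b = c * X - b"
  using nonzero by (simp add: X field_simps power2_eq_square)

lemma a'_eq: "(b * d + c * f) / a = b - c * X + d * Z"
proof -
  have "a * (b - c * X + d * Z) = b * d + c * f" using relZ by (simp add: algebra_simps)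
  then show ?thesis using nonzero by (simp add: field_simps)
qed

lemma cancel_a:
  assumes l: "l \<in> laurent_ring {(b * d + c * f) / a, b, c, d, f}" and al: "a * l \<in> R"
  shows "l \<in> R"
proof (rule laurent_cancel_prime[OF is_subring_R nonzero(1) _ _ l al])
  show "w \<in> R" if "w \<in> {(b * d + c * f) / a, b, c, d, f}" for w
    using that gens_in_R unfolding a'_eq by (auto intro!: is_subringD[OF is_subring_R])
  show "prime_to R a w" if "w \<in> {(b * d + c * f) / a, b, c, d, f}" for w
    using that unfolding a'_eq by (intro prime_to_a) auto
qed

lemma cancel_b:
  assumes l: "l \<in> laurent_ring {a, (c\<^sup>2 + a * d) / b, c, d, f}" and bl: "b * l \<in> R"
  shows "l \<in> R"
proof (rule laurent_cancel_prime[OF is_subring_R nonzero(2) _ _ l bl])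
  show "w \<in> R" if "w \<in> {a, (c\<^sup>2 + a * d) / b, c, d, f}" for w
    using that gens_in_R unfolding b'_eq by (auto intro!: is_subringD[OF is_subring_R])
  show "prime_to R b w" if "w \<in> {a, (c\<^sup>2 + a * d) / b, c, d, f}" for w
    using that unfolding b'_eq by (intro prime_to_b) auto
qed

end

section \<open>Mutations of the candidate ring\<close>

lemma is_subring_laurent_ring: "is_subring (laurent_ring C)"
  unfolding laurent_ring_def by (rule is_subring_subring_gen)

context cluster_tuple
begin

lemma sym_R: "cluster_tuple.R d c b a f X Z Y = R"
  unfolding R_def cluster_tuple.R_def[OF sym] by (rule arg_cong[of _ _ subring_gen]) auto

lemma cancel_c: "l \<in> laurent_ring {d, (b\<^sup>2 + d * a) / c, b, a, f} \<Longrightarrow> c * l \<in> R \<Longrightarrow> l \<in> R"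
  using cluster_tuple.cancel_b[OF sym] unfolding sym_R .

lemma cancel_d: "l \<in> laurent_ring {(c * a + b * f) / d, c, b, a, f} \<Longrightarrow> d * l \<in> R \<Longrightarrow> l \<in> R"
  using cluster_tuple.cancel_a[OF sym] unfolding sym_R .

lemma R_subset_laurent: "R \<subseteq> laurent_ring {a, b, c, d, f}"
proof -
  let ?L = "laurent_ring {a, b, c, d, f}"
  note L = is_subringD[OF is_subring_laurent_ring]
  have g: "a \<in> ?L" "b \<in> ?L" "c \<in> ?L" "d \<in> ?L" "f \<in> ?L"
    "inverse a \<in> ?L" "inverse b \<in> ?L" "inverse c \<in> ?L" "inverse d \<in> ?L" "inverse f \<in> ?L"
    by (auto simp: laurent_ring_def intro: subring_gen.base)
  have "X = (b * b + c * c + a * d) * inverse b * inverse c"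
    using nonzero by (simp add: X field_simps power2_eq_square)
  moreover have "Y = (a * d * d + a * c * c + b * c * f + b * b * d) * inverse a * inverse c * inverse d"
    using nonzero by (simp add: Y field_simps power2_eq_square)
  moreover have "Z = (a * a * d + a * c * c + b * c * f + b * b * d) * inverse a * inverse b * inverse d"
    using nonzero by (simp add: Z field_simps power2_eq_square)
  ultimately have "X \<in> ?L" "Y \<in> ?L" "Z \<in> ?L" by (simp_all only:) (intro L g)+
  then show ?thesis
    unfolding R_def using g by (intro subring_gen_minimal is_subring_laurent_ring) auto
qed

text \<open>\<open>W\<close> will be the upper cluster algebra, bounded by the initial cluster and
  its four neighbours alone. To remove one factor \<open>P\<close>, the variables a, b, c, d are
  stripped off in turn: each intermediate product still lies in \<open>W\<close>, hence in the
  Laurent ring that \<open>cancel_a\<close> to \<open>cancel_d\<close> ask for. The remaining factor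
  \<open>f\<close> is a unit.\<close>

lemma subset_R:
  assumes "is_subring W" "W \<subseteq> laurent_ring {a, b, c, d, f}" "R \<subseteq> W"
    "W \<subseteq> laurent_ring {(b * d + c * f) / a, b, c, d, f}" "W \<subseteq> laurent_ring {a, (c\<^sup>2 + a * d) / b, c, d, f}"
    "W \<subseteq> laurent_ring {d, (b\<^sup>2 + d * a) / c, b, a, f}" "W \<subseteq> laurent_ring {(c * a + b * f) / d, c, b, a, f}"
  shows "W \<subseteq> R"
proof
  fix x assume x: "x \<in> W"
  define P where "P = a * b * c * d * f"
  note W = is_subringD[OF assms(1)]
  have gW: "a \<in> W" "b \<in> W" "c \<in> W" "d \<in> W" "f \<in> W" using gens_in_R assms(3) by auto
  have PR: "P \<in> R" unfolding P_def by (intro is_subringD[OF is_subring_R] gens_in_R)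
  have step: "y \<in> R" if y: "y \<in> W" "y * P \<in> R" for y
  proof -
    have "a * (y * b * c * d * f) \<in> R" using y(2) by (simp add: P_def mult_ac)
    moreover have "y * b * c * d * f \<in> W" by (intro W(4) y gW)
    ultimately have "y * b * c * d * f \<in> R" using cancel_a assms(4) by blast
    then have "b * (y * c * d * f) \<in> R" by (simp add: mult_ac)
    moreover have "y * c * d * f \<in> W" by (intro W(4) y gW)
    ultimately have "y * c * d * f \<in> R" using cancel_b assms(5) by blast
    then have "c * (y * d * f) \<in> R" by (simp add: mult_ac)
    moreover have "y * d * f \<in> W" by (intro W(4) y gW)
    ultimately have "y * d * f \<in> R" using cancel_c assms(6) by blast
    then have "d * (y * f) \<in> R" by (simp add: mult_ac)
    moreover have "y * f \<in> W" by (intro W(4) y gW)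
    ultimately have "y * f \<in> R" using cancel_d assms(7) by blast
    then have "y * f * inverse f \<in> R" by (rule is_subringD(4)[OF is_subring_R _ gens_in_R(6)])
    then show ?thesis using nonzero by (simp add: mult.assoc)
  qed
  have "s \<in> R \<or> s * P \<in> R" if s: "s \<in> {a, b, c, d, f} \<union> inverse ` {a, b, c, d, f}" for s
  proof -
    have "inverse a * P = b * c * d * f" "inverse b * P = a * c * d * f" "inverse c * P = a * b * d * f"
      "inverse d * P = a * b * c * f" "inverse f * P = a * b * c * d"
      using nonzero by (simp_all add: P_def field_simps)
    moreover have "b * c * d * f \<in> R" "a * c * d * f \<in> R" "a * b * d * f \<in> R"
      "a * b * c * f \<in> R" "a * b * c * d \<in> R"
      by (intro is_subringD(4)[OF is_subring_R] gens_in_R)+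
    ultimately show ?thesis using s gens_in_R by auto
  qed
  moreover have "x \<in> subring_gen ({a, b, c, d, f} \<union> inverse ` {a, b, c, d, f})"
    using x assms(2) by (auto simp: laurent_ring_def)
  ultimately obtain N where "x * P ^ N \<in> R" using clear_denominators[OF is_subring_R PR] by blast
  then show "x \<in> R"
  proof (induction N)
    case (Suc N)
    then have "x * P ^ N * P \<in> R" by (simp add: mult_ac)
    moreover have "x * P ^ N \<in> W"
      using x PR assms(3) by (intro W(4) is_subring_power[OF assms(1)]) auto
    ultimately show ?case using step Suc.IH by blast
  qed simp
qed

text \<open>Mutation at the first position rotates both the cluster and the triple. Iterated, it is
  the recurrence x_n x_(n+4) = x_(n+1) x_(n+3) + f x_(n+2).\<close>

lemma move_a: "cluster_tuple b c d ((b * d + c * f) / a) f Y Z X"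
proof
  have i: "alg_indep [a, b, c, d, f]" by (rule indep)
  have nz: "b * d + c * f \<noteq> 0"
  proof -
    have i': "alg_indep [f, b, c, d]" using alg_indep_mset[OF _ indep, of "[a, f, b, c, d]"] by simp
    have "b * d + c * f \<noteq> 0" using i' nonzero
      by (intro transc_linear_nonzero[OF _ is_subring_subring_gen[of "{b, c, d}"]])
        (auto intro!: subring_gen.mult intro: subring_gen.base)
    then show ?thesis .
  qed
  have "alg_indep [(b * d + c * f) / a, b, c, d, f]"
    using nz by (intro alg_indep_divide i) (auto intro!: subring_gen_add subring_gen.mult intro: subring_gen.base)
  then show "alg_indep [b, c, d, (b * d + c * f) / a, f]" by (rule alg_indep_mset[rotated]) simp
  show "Y = (c\<^sup>2 + d\<^sup>2 + b * ((b * d + c * f) / a)) / (c * d)"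
    using nonzero by (simp add: Y field_simps power2_eq_square)
  show "Z = (b * ((b * d + c * f) / a)\<^sup>2 + b * d\<^sup>2 + c * d * f + c\<^sup>2 * ((b * d + c * f) / a)) / (b * d * ((b * d + c * f) / a))"
  proof -
    define e where "e = b * d + c * f"
    have "(b * (e / a)\<^sup>2 + b * d\<^sup>2 + c * d * f + c\<^sup>2 * (e / a)) / (b * d * (e / a))
      = (b * e\<^sup>2 + a\<^sup>2 * d * e + a * c\<^sup>2 * e) / (a * b * d * e)"
      using nonzero nz unfolding e_def[symmetric]
      by (simp add: field_simps power2_eq_square) (simp add: e_def algebra_simps)
    also have "\<dots> = (b * e + a\<^sup>2 * d + a * c\<^sup>2) / (a * b * d)"
      using nonzero nz unfolding e_def[symmetric] by (simp add: field_simps power2_eq_square)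
    also have "\<dots> = Z" by (simp add: Z e_def algebra_simps power2_eq_square)
    finally show ?thesis by (simp add: e_def)
  qed
  show "X = (b\<^sup>2 * ((b * d + c * f) / a) + b * d\<^sup>2 + c * d * f + c\<^sup>2 * ((b * d + c * f) / a)) / (b * c * ((b * d + c * f) / a))"
  proof -
    define e where "e = b * d + c * f"
    have "(b\<^sup>2 * (e / a) + b * d\<^sup>2 + c * d * f + c\<^sup>2 * (e / a)) / (b * c * (e / a))
      = (b\<^sup>2 * e + a * d * e + c\<^sup>2 * e) / (b * c * e)"
      using nonzero nz unfolding e_def[symmetric]
      by (simp add: field_simps power2_eq_square) (simp add: e_def algebra_simps)
    also have "\<dots> = X" using nonzero nz unfolding e_def[symmetric] by (simp add: X field_simps power2_eq_square)
    finally show ?thesis by (simp add: e_def)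
  qed
qed

lemma move_a_R: "cluster_tuple.R b c d ((b * d + c * f) / a) f Y Z X \<subseteq> R"
  unfolding cluster_tuple.R_def[OF move_a]
proof (rule subring_gen_minimal[OF _ is_subring_R])
  have "(b * d + c * f) / a \<in> R" unfolding a'_eq by (intro is_subringD[OF is_subring_R] gens_in_R)
  then show "{f, inverse f, b, c, d, (b * d + c * f) / a, Y, Z, X} \<subseteq> R" using gens_in_R by auto
qed

text \<open>The new variable b' satisfies b + b' = c X, so \<open>X\<close> is common to the pairs
  b, c and c, b'. \<open>Z\<close> moves to the second slot and \<open>X * Z - Y\<close> fills the
  third, so \<open>Y\<close> can be recovered from the new triple.\<close>

lemma move_b: "cluster_tuple a c ((c\<^sup>2 + a * d) / b) d f X Z (X * Z - Y)"
proof
  have i: "alg_indep [b, a, c, d, f]" by (rule alg_indep_swap[OF indep])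
  have nz: "c\<^sup>2 + a * d \<noteq> 0"
  proof -
    have i': "alg_indep [d, a, c, f]" using alg_indep_mset[OF _ indep, of "[b, d, a, c, f]"] by simp
    have "c * c + a * d \<noteq> 0" using i' nonzero
      by (intro transc_linear_nonzero[OF _ is_subring_subring_gen[of "{a, c, f}"]])
        (auto intro!: subring_gen.mult intro: subring_gen.base)
    then show ?thesis by (simp add: power2_eq_square)
  qed
  have "alg_indep [(c\<^sup>2 + a * d) / b, a, c, d, f]" unfolding power2_eq_square
    using nz by (intro alg_indep_divide i) (auto simp: power2_eq_square intro!: subring_gen_add subring_gen.mult intro: subring_gen.base)
  then show "alg_indep [a, c, (c\<^sup>2 + a * d) / b, d, f]" by (rule alg_indep_mset[rotated]) simp
  define e where "e = c\<^sup>2 + a * d"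
  have e: "e \<noteq> 0" "c\<^sup>2 + a * d = e" using nz by (auto simp: e_def)
  show "X = (c\<^sup>2 + ((c\<^sup>2 + a * d) / b)\<^sup>2 + a * d) / (c * ((c\<^sup>2 + a * d) / b))"
  proof -
    have "(c\<^sup>2 + (e / b)\<^sup>2 + a * d) / (c * (e / b)) = (e + (e / b)\<^sup>2) / (c * (e / b))"
      by (simp add: e_def)
    also have "\<dots> = (b\<^sup>2 + e) / (b * c)" using e(1) nonzero by (simp add: field_simps power2_eq_square)
    also have "\<dots> = X" by (simp add: X e_def algebra_simps)
    finally show ?thesis unfolding e by simp
  qed
  show "Z = (a * d\<^sup>2 + a * ((c\<^sup>2 + a * d) / b)\<^sup>2 + c * ((c\<^sup>2 + a * d) / b) * f + c\<^sup>2 * d) / (a * ((c\<^sup>2 + a * d) / b) * d)"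
  proof -
    have "(a * d\<^sup>2 + a * (e / b)\<^sup>2 + c * (e / b) * f + c\<^sup>2 * d) / (a * (e / b) * d)
      = (d * e + a * (e / b)\<^sup>2 + c * (e / b) * f) / (a * (e / b) * d)"
      by (simp add: e_def algebra_simps power2_eq_square)
    also have "\<dots> = (b\<^sup>2 * d + a * e + b * c * f) / (a * b * d)" using e(1) nonzero by (simp add: field_simps power2_eq_square)
    also have "\<dots> = Z" by (simp add: Z e_def algebra_simps power2_eq_square)
    finally show ?thesis unfolding e by simp
  qed
  show "X * Z - Y = (a\<^sup>2 * d + a * ((c\<^sup>2 + a * d) / b)\<^sup>2 + c * ((c\<^sup>2 + a * d) / b) * f + c\<^sup>2 * d) / (a * c * d)"
    using nonzero by (simp add: X Y Z field_simps power2_eq_square)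
qed

lemma move_b_R: "cluster_tuple.R a c ((c\<^sup>2 + a * d) / b) d f X Z (X * Z - Y) \<subseteq> R"
  unfolding cluster_tuple.R_def[OF move_b]
proof (rule subring_gen_minimal[OF _ is_subring_R])
  have "(c\<^sup>2 + a * d) / b \<in> R" "X * Z - Y \<in> R"
    unfolding b'_eq by (intro is_subringD[OF is_subring_R] gens_in_R)+
  then show "{f, inverse f, a, c, (c\<^sup>2 + a * d) / b, d, X, Z, X * Z - Y} \<subseteq> R" using gens_in_R by auto
qed


text \<open>\<open>move_b\<close> conjugated by the symmetry; the outer \<open>sym\<close> restores
  the order of the cluster.\<close>

lemma move_c: "cluster_tuple a ((b\<^sup>2 + d * a) / c) b d f X (X * Y - Z) Y"
  using cluster_tuple.sym[OF cluster_tuple.move_b[OF sym]] .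

lemma move_c_R: "cluster_tuple.R a ((b\<^sup>2 + d * a) / c) b d f X (X * Y - Z) Y \<subseteq> R"
  using cluster_tuple.move_b_R[OF sym] unfolding sym_R cluster_tuple.sym_R[OF move_c, symmetric] .

lemma move_d: "cluster_tuple ((c * a + b * f) / d) a b c f Z X Y"
  using cluster_tuple.sym[OF cluster_tuple.move_a[OF sym]] .

lemma move_d_R: "cluster_tuple.R ((c * a + b * f) / d) a b c f Z X Y \<subseteq> R"
  using cluster_tuple.move_a_R[OF sym] unfolding sym_R cluster_tuple.sym_R[OF move_d, symmetric] .


text \<open>Only one inclusion is computed. The other is the same kind of inclusion for the inverse
  mutation, which in the rotated tuple is \<open>move_d\<close>; for \<open>move_b\<close> the
  inverse is \<open>move_c\<close>.\<close>

lemma move_a_R_eq: "cluster_tuple.R b c d ((b * d + c * f) / a) f Y Z X = R"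
proof
  have nz: "b * d + c * f \<noteq> 0" using cluster_tuple.nonzero(4)[OF move_a] by auto
  have "(d * b + c * f) / ((b * d + c * f) / a) = a" using nz nonzero by (simp add: field_simps)
  then show "R \<subseteq> cluster_tuple.R b c d ((b * d + c * f) / a) f Y Z X"
    using cluster_tuple.move_d_R[OF move_a] by simp
qed (rule move_a_R)

lemma move_b_R_eq: "cluster_tuple.R a c ((c\<^sup>2 + a * d) / b) d f X Z (X * Z - Y) = R"
proof
  have nz: "c\<^sup>2 + a * d \<noteq> 0" using cluster_tuple.nonzero(3)[OF move_b] by auto
  have "(c\<^sup>2 + d * a) / ((c\<^sup>2 + a * d) / b) = b" using nz nonzero by (simp add: field_simps)
  then show "R \<subseteq> cluster_tuple.R a c ((c\<^sup>2 + a * d) / b) d f X Z (X * Z - Y)"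
    using cluster_tuple.move_c_R[OF move_b] by simp
qed (rule move_b_R)


lemma move_c_R_eq: "cluster_tuple.R a ((b\<^sup>2 + d * a) / c) b d f X (X * Y - Z) Y = R"
  using cluster_tuple.move_b_R_eq[OF sym] unfolding sym_R cluster_tuple.sym_R[OF move_c, symmetric] .

lemma move_d_R_eq: "cluster_tuple.R ((c * a + b * f) / d) a b c f Z X Y = R"
  using cluster_tuple.move_a_R_eq[OF sym] unfolding sym_R cluster_tuple.sym_R[OF move_d, symmetric] .

end

section \<open>Seeds in the mutation class\<close>

lemma prod_filter_5:
  "(\<Prod>j\<in>{j::nat. j < 5 \<and> P j}. g j) = (\<Prod>j<5. if P j then g j else (1::'a::comm_monoid_mult))"
proof -
  have "{j::nat. j < 5 \<and> P j} = {j \<in> {..<5}. P j}" by auto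
  then show ?thesis using prod.inter_filter[of "{..<5}" g P] by simp
qed

lemma lessThan_5: "{..<5} = {0, 1, 2, 3, 4::nat}"
  by auto

lemma lessThan_4: "{..<4} = {0, 1, 2, 3::nat}"
  by auto

lemma permutes_of_list:
  assumes "set xs = {..<n}" "length xs = n" "n \<le> m"
  shows "(\<lambda>i. if i < n then xs ! i else i) permutes {..<m}"
    "(\<lambda>i. if i < n then xs ! i else i) ` {..<n} = {..<n}"
proof -
  let ?s = "\<lambda>i. if i < n then xs ! i else i"
  have "distinct xs" using assms by (intro card_distinct) simp
  then have "bij_betw (\<lambda>i. xs ! i) {..<n} {..<n}" using assms by (intro bij_betw_nth) auto
  moreover have "bij_betw ?s {..<n} {..<n} = bij_betw (\<lambda>i. xs ! i) {..<n} {..<n}"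
    by (rule bij_betw_cong) auto
  ultimately have b: "bij_betw ?s {..<n} {..<n}" by simp
  have "bij_betw ?s {n..<m} {n..<m} = bij_betw id {n..<m} {n..<m}" by (rule bij_betw_cong) auto
  then have "bij_betw ?s ({..<n} \<union> {n..<m}) ({..<n} \<union> {n..<m})" using b by (intro bij_betw_combine) auto
  moreover have "{..<n} \<union> {n..<m} = {..<m}" using assms(3) by auto
  ultimately show "?s permutes {..<m}" using assms(3) by (intro bij_imp_permutes) auto
  show "?s ` {..<n} = {..<n}" using b by (simp add: bij_betw_def)
qed

lemma permute_seed_comp: "permute_seed \<tau> (permute_seed \<sigma> s) = permute_seed (\<sigma> \<circ> \<tau>) s"
  by (cases s) (simp add: permute_seed_def)

lemma permute_seed_mutate:
  assumes \<sigma>: "\<sigma> permutes {..<n}"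
  shows "permute_seed \<sigma> (mutate n (\<sigma> k) s) = mutate n k (permute_seed \<sigma> s)"
proof -
  obtain x B where s: "s = (x, B)" by (cases s)
  have inj: "\<sigma> i = \<sigma> j \<longleftrightarrow> i = j" for i j using permutes_inj[OF \<sigma>] by (auto simp: inj_def)
  have bij: "bij_betw \<sigma> {j. j < n \<and> P (\<sigma> j)} {j. j < n \<and> P j}" for P
    unfolding bij_betw_def
  proof
    show "inj_on \<sigma> {j. j < n \<and> P (\<sigma> j)}" using inj by (simp add: inj_on_def)
    have "{j. j < n \<and> P j} = {j \<in> \<sigma> ` {..<n}. P j}" using permutes_image[OF \<sigma>] by auto
    then show "\<sigma> ` {j. j < n \<and> P (\<sigma> j)} = {j. j < n \<and> P j}" by auto
  qed
  have p: "(\<Prod>j\<in>{j. j < n \<and> P (\<sigma> j)}. g (\<sigma> j)) = (\<Prod>j\<in>{j. j < n \<and> P j}. g j)" for P and g :: "nat \<Rightarrow> 'a"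
    by (rule prod.reindex_bij_betw[OF bij])
  show ?thesis
    using p[where P = "\<lambda>j. B j (\<sigma> k) > 0" and g = "\<lambda>j. x j ^ nat (B j (\<sigma> k))"]
      p[where P = "\<lambda>j. B j (\<sigma> k) < 0" and g = "\<lambda>j. x j ^ nat (- B j (\<sigma> k))"]
    by (auto simp: s mutate_def permute_seed_def fun_eq_iff inj)
qed

text \<open>If \<open>B k k\<close> were nonzero, the old variable would occur in its own exchange
  polynomial; a zero new variable could not be inverted. The lemma serves to traverse mutation steps
  backwards.\<close>

lemma mutate_mutate:
  assumes B: "B k k = 0" and nz: "fst (mutate n k (x, B)) k \<noteq> 0"
  shows "mutate n k (mutate n k (x, B)) = (x, B)"
proof -
  define p q where "p = (\<Prod>j\<in>{j. j < n \<and> B j k > 0}. x j ^ nat (B j k))"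
    and "q = (\<Prod>j\<in>{j. j < n \<and> B j k < 0}. x j ^ nat (- B j k))"
  obtain x' B' where m: "mutate n k (x, B) = (x', B')" by (cases "mutate n k (x, B)")
  have x': "x' = x(k := (p + q) * inverse (x k))"
    using m by (auto simp: mutate_def p_def q_def)
  have B': "B' = (\<lambda>i j. if i = k \<or> j = k then - B i j
            else B i j + (\<bar>B i k\<bar> * B k j + B i k * \<bar>B k j\<bar>) div 2)"
    using m by (auto simp: mutate_def)
  \<comment> \<open>Column \<open>k\<close> changes sign, so the two products trade places; as
    \<open>B k k = 0\<close>, neither contains the variable that has changed.\<close>
  have p': "(\<Prod>j\<in>{j. j < n \<and> B' j k < 0}. x' j ^ nat (- B' j k)) = p"
    unfolding p_def by (rule prod.cong) (use B in \<open>auto simp: x' B'\<close>)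
  have q': "(\<Prod>j\<in>{j. j < n \<and> B' j k > 0}. x' j ^ nat (B' j k)) = q"
    unfolding q_def by (rule prod.cong) (use B in \<open>auto simp: x' B'\<close>)
  have "(p + q) * inverse (x k) \<noteq> 0" using nz by (simp add: m x')
  then have xk: "(q + p) * inverse (x' k) = x k" by (simp add: x' field_simps)
  have "fst (mutate n k (x', B')) = x'(k := (q + p) * inverse (x' k))" by (simp add: mutate_def p' q')
  then have 1: "fst (mutate n k (x', B')) = x" unfolding xk by (simp add: x')
  have 2: "snd (mutate n k (x', B')) i j = B i j" for i j
  proof (cases "i = k \<or> j = k")
    case False
    \<comment> \<open>\<open>2 * t\<close> exhibits the correction as even, so \<open>div 2\<close>
      is exact for it and for its negative, and the two corrections cancel.\<close>
    define t where "t = (if B i k \<ge> 0 \<and> B k j \<ge> 0 then B i k * B k j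
      else if B i k < 0 \<and> B k j < 0 then - (B i k * B k j) else 0)"
    have t: "\<bar>B i k\<bar> * B k j + B i k * \<bar>B k j\<bar> = 2 * t" by (auto simp: t_def abs_if)
    have "\<bar>B i k\<bar> * (- B k j) + (- B i k) * \<bar>B k j\<bar> = 2 * (- t)" using t by simp
    then show ?thesis using False t by (simp add: mutate_def B')
  qed (auto simp: mutate_def B')
  show ?thesis using 1 2 by (simp add: m prod_eq_iff fun_eq_iff)
qed

section \<open>The invariant of the mutation class\<close>

definition exchange_matrix :: "nat \<Rightarrow> nat \<Rightarrow> int" where
  "exchange_matrix = (\<lambda>i j. [[ 0, -1,  1, -1],
                          [ 1,  0, -2,  1],
                          [-1,  2,  0, -1],
                          [ 1, -1,  1,  0],
                          [-1,  0,  0,  1]] ! i ! j)"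

text \<open>One fixed ring \<open>S\<close> is carried along together with the matrix and the
  cluster. The matrix is compared only in the meaningful range, since mutation does not control the
  other values of \<open>B\<close>.\<close>

definition canonical_seed :: "'a::field_char_0 set \<Rightarrow> 'a seed \<Rightarrow> bool" where
  "canonical_seed S = (\<lambda>(x, B). (\<forall>i<5. \<forall>j<4. B i j = exchange_matrix i j) \<and>
     (\<exists>X Y Z. cluster_tuple (x 0) (x 1) (x 2) (x 3) (x 4) X Y Z \<and>
        cluster_tuple.R (x 0) (x 1) (x 2) (x 3) (x 4) X Y Z = S))"

definition index_perm :: "(nat \<Rightarrow> nat) \<Rightarrow> bool" where
  "index_perm \<sigma> \<longleftrightarrow> \<sigma> permutes {..<5} \<and> \<sigma> ` {..<4} = {..<4}"

text \<open>The relabelling is built in because a mutation reproduces the matrix only after a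
  permutation of the indices.\<close>

definition good_seed :: "'a::field_char_0 set \<Rightarrow> 'a seed \<Rightarrow> bool" where
  "good_seed S s \<longleftrightarrow> (\<exists>\<sigma>. index_perm \<sigma> \<and> canonical_seed S (permute_seed \<sigma> s))"

lemma index_perm_comp: "index_perm \<sigma> \<Longrightarrow> index_perm \<tau> \<Longrightarrow> index_perm (\<sigma> \<circ> \<tau>)"
  unfolding index_perm_def image_comp[symmetric] by (simp add: permutes_compose)

lemma index_perm_inv: "index_perm \<sigma> \<Longrightarrow> index_perm (inv \<sigma>)"
  unfolding index_perm_def
  by (metis permutes_inv permutes_inj inj_imp_surj_inv image_inv_f_f)

lemma index_perm_list:
  "set xs = {..<4} \<Longrightarrow> length xs = 4 \<Longrightarrow> index_perm (\<lambda>i. if i < 4 then xs ! i else i)"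
  unfolding index_perm_def using permutes_of_list[of xs 4 5] by simp

lemma all_less_5: "(\<forall>i<5. P i) \<longleftrightarrow> P 0 \<and> P 1 \<and> P 2 \<and> P 3 \<and> P (4::nat)"
  using lessThan_5 by (auto simp flip: lessThan_iff)

lemma all_less_4: "(\<forall>i<4. P i) \<longleftrightarrow> P 0 \<and> P 1 \<and> P 2 \<and> P (3::nat)"
  using lessThan_4 by (auto simp flip: lessThan_iff)

lemma fst_mutate_canonical:
  assumes B: "\<forall>i<5. \<forall>j<4. B i j = exchange_matrix i j"
  shows "fst (mutate 5 0 (x, B)) = x(0 := (x 1 * x 3 + x 2 * x 4) / x 0)"
    "fst (mutate 5 1 (x, B)) = x(1 := ((x 2)\<^sup>2 + x 0 * x 3) / x 1)"
    "fst (mutate 5 2 (x, B)) = x(2 := ((x 1)\<^sup>2 + x 3 * x 0) / x 2)"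
    "fst (mutate 5 3 (x, B)) = x(3 := (x 2 * x 0 + x 1 * x 4) / x 3)"
proof -
  note B' = B[unfolded all_less_5 all_less_4, unfolded exchange_matrix_def, simplified]
  have fst_eq: "fst (mutate 5 k (x, B)) = x(k := ((\<Prod>j<5. if B j k > 0 then x j ^ nat (B j k) else 1)
      + (\<Prod>j<5. if B j k < 0 then x j ^ nat (- B j k) else 1)) / x k)" for k
    by (simp add: mutate_def prod_filter_5 divide_inverse)
  show "fst (mutate 5 0 (x, B)) = x(0 := (x 1 * x 3 + x 2 * x 4) / x 0)"
    unfolding fst_eq using B' by (simp add: lessThan_5 ac_simps)
  show "fst (mutate 5 1 (x, B)) = x(1 := ((x 2)\<^sup>2 + x 0 * x 3) / x 1)"
    unfolding fst_eq using B' by (simp add: lessThan_5 ac_simps)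
  show "fst (mutate 5 2 (x, B)) = x(2 := ((x 1)\<^sup>2 + x 3 * x 0) / x 2)"
    unfolding fst_eq using B' by (simp add: lessThan_5 ac_simps)
  show "fst (mutate 5 3 (x, B)) = x(3 := (x 2 * x 0 + x 1 * x 4) / x 3)"
    unfolding fst_eq using B' by (simp add: lessThan_5 ac_simps)
qed

text \<open>The list in each case records the old positions in the order in which
  \<open>move_a\<close>, \<open>move_b\<close>, \<open>move_c\<close> or \<open>move_d\<close>
  arranges the mutated cluster.\<close>

lemma canonical_seed_mutate:
  assumes s: "canonical_seed S s" and k: "k < 4"
  shows "good_seed S (mutate 5 k s)"
proof -
  obtain x B where sx: "s = (x, B)" by (cases s)
  obtain X Y Z where M: "cluster_tuple (x 0) (x 1) (x 2) (x 3) (x 4) X Y Z"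
    and R: "cluster_tuple.R (x 0) (x 1) (x 2) (x 3) (x 4) X Y Z = S"
    using s by (auto simp: canonical_seed_def sx)
  have B: "\<forall>i<5. \<forall>j<4. B i j = exchange_matrix i j" using s by (simp add: canonical_seed_def sx)
  note B' = B[unfolded all_less_5 all_less_4, unfolded exchange_matrix_def, simplified]
  note mut = cluster_tuple.move_a[OF M] cluster_tuple.move_b[OF M] cluster_tuple.move_c[OF M] cluster_tuple.move_d[OF M]
  note mutR = cluster_tuple.move_a_R_eq[OF M, unfolded R] cluster_tuple.move_b_R_eq[OF M, unfolded R]
    cluster_tuple.move_c_R_eq[OF M, unfolded R] cluster_tuple.move_d_R_eq[OF M, unfolded R]
  have *: "good_seed S (mutate 5 k s)"
    if xs: "set xs = {..<4}" "length xs = 4"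
      and c: "canonical_seed S (permute_seed (\<lambda>i. if i < 4 then xs ! i else i) (mutate 5 k s))" for xs
    unfolding good_seed_def using index_perm_list[OF xs] c by blast
  have snd_eq: "snd (mutate 5 k s) = (\<lambda>i j. if i = k \<or> j = k then - B i j
      else B i j + (\<bar>B i k\<bar> * B k j + B i k * \<bar>B k j\<bar>) div 2)" for k
    by (simp add: sx mutate_def)
  have can: "canonical_seed S (permute_seed \<sigma> t)"
    if "\<forall>i<5. \<forall>j<4. snd t (\<sigma> i) (\<sigma> j) = exchange_matrix i j"
      "cluster_tuple (fst t (\<sigma> 0)) (fst t (\<sigma> 1)) (fst t (\<sigma> 2)) (fst t (\<sigma> 3)) (fst t (\<sigma> 4)) X' Y' Z'"
      "cluster_tuple.R (fst t (\<sigma> 0)) (fst t (\<sigma> 1)) (fst t (\<sigma> 2)) (fst t (\<sigma> 3)) (fst t (\<sigma> 4)) X' Y' Z' = S"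
    for \<sigma> t X' Y' Z'
    using that by (cases t) (auto simp: canonical_seed_def permute_seed_def)
  consider "k = 0" | "k = 1" | "k = 2" | "k = 3" using k by linarith
  then show ?thesis
  proof cases
    case 1
    have f: "fst (mutate 5 k s) = x(0 := (x 1 * x 3 + x 2 * x 4) / x 0)"
      unfolding 1 sx by (rule fst_mutate_canonical(1)[OF B])
    show ?thesis
    proof (rule *[of "[1, 2, 3, 0]", OF _ _ can])
      show "\<forall>i<5. \<forall>j<4. snd (mutate 5 k s) (if i < 4 then [1, 2, 3, 0] ! i else i) (if j < 4 then [1, 2, 3, 0] ! j else j) = exchange_matrix i j"
        unfolding snd_eq 1 using B' by (simp add: all_less_5 all_less_4 exchange_matrix_def)
    qed (use mut(1) mutR(1) in \<open>auto simp: f lessThan_4\<close>)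
  next
    case 2
    have f: "fst (mutate 5 k s) = x(1 := ((x 2)\<^sup>2 + x 0 * x 3) / x 1)"
      unfolding 2 sx by (rule fst_mutate_canonical(2)[OF B])
    show ?thesis
    proof (rule *[of "[0, 2, 1, 3]", OF _ _ can])
      show "\<forall>i<5. \<forall>j<4. snd (mutate 5 k s) (if i < 4 then [0, 2, 1, 3] ! i else i) (if j < 4 then [0, 2, 1, 3] ! j else j) = exchange_matrix i j"
        unfolding snd_eq 2 using B' by (simp add: all_less_5 all_less_4 exchange_matrix_def)
    qed (use mut(2) mutR(2) in \<open>auto simp: f lessThan_4\<close>)
  next
    case 3
    have f: "fst (mutate 5 k s) = x(2 := ((x 1)\<^sup>2 + x 3 * x 0) / x 2)"
      unfolding 3 sx by (rule fst_mutate_canonical(3)[OF B])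
    show ?thesis
    proof (rule *[of "[0, 2, 1, 3]", OF _ _ can])
      show "\<forall>i<5. \<forall>j<4. snd (mutate 5 k s) (if i < 4 then [0, 2, 1, 3] ! i else i) (if j < 4 then [0, 2, 1, 3] ! j else j) = exchange_matrix i j"
        unfolding snd_eq 3 using B' by (simp add: all_less_5 all_less_4 exchange_matrix_def)
    qed (use mut(3) mutR(3) in \<open>auto simp: f lessThan_4\<close>)
  next
    case 4
    have f: "fst (mutate 5 k s) = x(3 := (x 2 * x 0 + x 1 * x 4) / x 3)"
      unfolding 4 sx by (rule fst_mutate_canonical(4)[OF B])
    show ?thesis
    proof (rule *[of "[3, 0, 1, 2]", OF _ _ can])
      show "\<forall>i<5. \<forall>j<4. snd (mutate 5 k s) (if i < 4 then [3, 0, 1, 2] ! i else i) (if j < 4 then [3, 0, 1, 2] ! j else j) = exchange_matrix i j"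
        unfolding snd_eq 4 using B' by (simp add: all_less_5 all_less_4 exchange_matrix_def)
    qed (use mut(4) mutR(4) in \<open>auto simp: f lessThan_4\<close>)
  qed
qed

lemma good_seed_permute:
  assumes "good_seed S s" "index_perm \<tau>"
  shows "good_seed S (permute_seed \<tau> s)"
proof -
  obtain \<sigma> where \<sigma>: "index_perm \<sigma>" "canonical_seed S (permute_seed \<sigma> s)" using assms by (auto simp: good_seed_def)
  have "\<tau> \<circ> (inv \<tau> \<circ> \<sigma>) = \<sigma>"
    using permutes_inv_o(1)[of \<tau> "{..<5}"] assms(2) by (simp add: index_perm_def o_assoc)
  then have "permute_seed (inv \<tau> \<circ> \<sigma>) (permute_seed \<tau> s) = permute_seed \<sigma> s"
    by (simp add: permute_seed_comp)
  moreover have "index_perm (inv \<tau> \<circ> \<sigma>)" using \<sigma>(1) assms(2) by (intro index_perm_comp index_perm_inv)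
  ultimately show ?thesis unfolding good_seed_def using \<sigma>(2) by metis
qed

text \<open>By \<open>permute_seed_mutate\<close>, mutation at \<open>k = \<sigma> k'\<close>
  becomes mutation at \<open>k'\<close> of the canonical relabelling.\<close>

lemma good_seed_mutate:
  assumes "good_seed S s" "k < 4"
  shows "good_seed S (mutate 5 k s)"
proof -
  obtain \<sigma> where \<sigma>: "index_perm \<sigma>" "canonical_seed S (permute_seed \<sigma> s)" using assms by (auto simp: good_seed_def)
  have "k \<in> \<sigma> ` {..<4}" using \<sigma>(1) assms(2) by (auto simp: index_perm_def)
  then obtain k' where k': "k' < 4" "k = \<sigma> k'" by auto
  have "good_seed S (permute_seed \<sigma> (mutate 5 k s))"
    using \<sigma> k' canonical_seed_mutate by (simp add: permute_seed_mutate index_perm_def)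
  then obtain \<tau> where "index_perm \<tau>" "canonical_seed S (permute_seed (\<sigma> \<circ> \<tau>) (mutate 5 k s))"
    by (auto simp: good_seed_def permute_seed_comp)
  then show ?thesis unfolding good_seed_def using index_perm_comp[OF \<sigma>(1)] by blast
qed

text \<open>Supplies the side conditions of \<open>mutate_mutate\<close>.\<close>

lemma good_seed_entries:
  assumes "good_seed S (x, B)" "k < 4"
  shows "B k k = 0" "x k \<noteq> 0"
proof -
  obtain \<sigma> where \<sigma>: "index_perm \<sigma>" "canonical_seed S (permute_seed \<sigma> (x, B))" using assms by (auto simp: good_seed_def)
  have "k \<in> \<sigma> ` {..<4}" using \<sigma>(1) assms(2) by (auto simp: index_perm_def)
  then obtain k' where k': "k' < 4" "k = \<sigma> k'" by auto
  have "B (\<sigma> k') (\<sigma> k') = exchange_matrix k' k'" using \<sigma>(2) k' by (auto simp: canonical_seed_def permute_seed_def)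
  also have "\<dots> = 0" using k'(1) by (auto simp: exchange_matrix_def numeral_eq_Suc less_Suc_eq)
  finally show "B k k = 0" using k' by simp
  obtain X Y Z where "cluster_tuple (x (\<sigma> 0)) (x (\<sigma> 1)) (x (\<sigma> 2)) (x (\<sigma> 3)) (x (\<sigma> 4)) X Y Z"
    using \<sigma>(2) by (auto simp: canonical_seed_def permute_seed_def)
  from cluster_tuple.nonzero[OF this] have "\<forall>i<4. x (\<sigma> i) \<noteq> 0" by (simp add: all_less_4)
  then show "x k \<noteq> 0" using k' by simp
qed

lemma good_seed_mutation_equivalent:
  assumes "mutation_equivalent 5 4 s t" "good_seed S s"
  shows "good_seed S t"
  using assms unfolding mutation_equivalent_def
proof (induction rule: equivclp_induct)
  case base
  then show ?case .
next
  case (step t u)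
  then have t: "good_seed S t" by simp
  from step(2) show ?case
  proof
    assume "seed_step 5 4 t u"
    then consider k where "k < 4" "u = mutate 5 k t"
      | \<sigma> where "index_perm \<sigma>" "u = permute_seed \<sigma> t" by (auto simp: seed_step_def index_perm_def)
    then show ?thesis using good_seed_mutate[OF t] good_seed_permute[OF t] by cases auto
  next
    \<comment> \<open>The equivalence closure also runs steps backwards: \<open>u\<close> is then
      \<open>t\<close> mutated again at the same index, or relabelled by the inverse
      permutation.\<close>
    assume "seed_step 5 4 u t"
    then consider k where "k < 4" "t = mutate 5 k u"
      | \<sigma> where "index_perm \<sigma>" "t = permute_seed \<sigma> u" by (auto simp: seed_step_def index_perm_def)
    then show ?thesis
    proof cases
      case (1 k)
      obtain x B where u: "u = (x, B)" by (cases u)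
      obtain x' B' where t': "t = (x', B')" by (cases t)
      \<comment> \<open>Known for the good seed \<open>t\<close>; it passes to the diagonal entry of
        \<open>B\<close> because mutation negates column \<open>k\<close>.\<close>
      have "B' k k = 0" "x' k \<noteq> 0" using good_seed_entries[of S x' B' k] t 1(1) by (simp_all add: t')
      moreover have "fst (mutate 5 k (x, B)) = x'" "B' = snd (mutate 5 k (x, B))"
        using 1(2) unfolding u t' by (metis fst_conv, metis snd_conv)
      moreover have "snd (mutate 5 k (x, B)) k k = - B k k" by (simp add: mutate_def)
      ultimately have "mutate 5 k t = u"
        unfolding 1(2) u by (intro mutate_mutate) auto
      then show ?thesis using good_seed_mutate[OF t 1(1)] by simp
    next
      case (2 \<sigma>)
      have "permute_seed (inv \<sigma>) t = u"
        using 2 permutes_inverses(1)[of \<sigma> "{..<5}"] by (cases u) (simp add: permute_seed_comp index_perm_def permute_seed_def)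
      then show ?thesis using good_seed_permute[OF t index_perm_inv[OF 2(1)]] by simp
    qed
  qed
qed

lemma good_seed_subset_laurent:
  assumes "good_seed S s"
  shows "S \<subseteq> laurent_ring (fst s ` {..<5})"
proof -
  obtain x B where s: "s = (x, B)" by (cases s)
  obtain \<sigma> where \<sigma>: "index_perm \<sigma>" "canonical_seed S (permute_seed \<sigma> s)" using assms by (auto simp: good_seed_def)
  have "fst s ` {..<5} = x ` \<sigma> ` {..<5}" using \<sigma>(1) permutes_image[of \<sigma> "{..<5}"] by (simp add: s index_perm_def)
  also have "\<dots> = {x (\<sigma> 0), x (\<sigma> 1), x (\<sigma> 2), x (\<sigma> 3), x (\<sigma> 4)}" by (simp add: lessThan_5)
  finally have eq: "fst s ` {..<5} = {x (\<sigma> 0), x (\<sigma> 1), x (\<sigma> 2), x (\<sigma> 3), x (\<sigma> 4)}" .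
  obtain X Y Z where "cluster_tuple (x (\<sigma> 0)) (x (\<sigma> 1)) (x (\<sigma> 2)) (x (\<sigma> 3)) (x (\<sigma> 4)) X Y Z"
      "cluster_tuple.R (x (\<sigma> 0)) (x (\<sigma> 1)) (x (\<sigma> 2)) (x (\<sigma> 3)) (x (\<sigma> 4)) X Y Z = S"
    using \<sigma>(2) by (auto simp: s canonical_seed_def permute_seed_def)
  then show ?thesis unfolding eq using cluster_tuple.R_subset_laurent by blast
qed

section \<open>The ideal of relations\<close>

lemma poly_map_poly_hom:
  assumes h: "is_ring_hom h"
  shows "poly (map_poly h p) (h x) = h (poly p x)"
  by (induction p) (simp_all add: is_ring_homD[OF h] map_poly_pCons)

text \<open>Induction on the list: the images of the coefficients of a polynomial in the head must
  all vanish. It allows computations with symbols of \<open>gen_poly\<close> to be carried out on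
  their values in the field.\<close>

lemma ring_hom_eq_0_iff_alg_indep:
  fixes h :: "'r::comm_ring_1 \<Rightarrow> 's::{comm_ring_1,ring_char_0}"
  assumes h: "is_ring_hom h" and "alg_indep (map h xs)" "p \<in> subring_gen (set xs)"
  shows "h p = 0 \<longleftrightarrow> p = 0"
proof -
  have "p = 0" if "h p = 0"
    using assms(2,3) that
  proof (induction xs arbitrary: p)
    case Nil
    \<comment> \<open>Without generators the subring consists of integers, on which \<open>h\<close>
      is injective because the target has characteristic zero.\<close>
    have hn: "h (of_nat n) = of_nat n" for n
      by (induction n) (simp_all add: is_ring_homD[OF h])
    have hi: "h (of_int k) = of_int k" for k
      by (cases k rule: int_cases2) (simp_all add: is_ring_homD[OF h] hn)
    from Nil(2) have "\<exists>k. p = of_int k"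
    proof induction
      case one
      show ?case by (intro exI[of _ 1]) simp
    next
      case (diff u v)
      then show ?case by (metis of_int_diff)
    next
      case (mult u v)
      then show ?case by (metis of_int_mult)
    qed simp
    then obtain k where k: "p = of_int k" by blast
    have "of_int k = (0::'s)" using Nil(3) hi[of k] k by simp
    then show ?case using k by simp
  next
    case (Cons x xs)
    obtain P where P: "P \<in> poly_over (subring_gen (set xs))" "p = poly P x"
      using Cons.prems(2) by (auto simp: subring_gen_insert adjoin_def)
    have "poly (map_poly h P) (h x) = 0" using Cons.prems(3) P(2) by (simp add: poly_map_poly_hom[OF h])
    moreover have "map_poly h P \<in> poly_over (subring_gen (set (map h xs)))"
      using P(1) ring_hom_image_subring_gen[OF h, of "set xs"]
      by (auto simp: poly_over_def coeff_map_poly is_ring_homD[OF h])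
    ultimately have "map_poly h P = 0" using Cons.prems(1) by (auto simp: transc_def)
    then have "h (coeff P i) = 0" for i
      using coeff_map_poly[of h P i] is_ring_homD(1)[OF h] by simp
    then have "coeff P i = 0" for i using Cons.IH[OF _ poly_overD[OF P(1)]] Cons.prems(1) by simp
    then have "P = 0" by (simp add: poly_eq_iff)
    then show ?case using P(2) by simp
  qed
  then show ?thesis using is_ring_homD(1)[OF h] by blast
qed

lemma is_subring_INT: "(\<And>C. C \<in> \<C> \<Longrightarrow> is_subring (g C)) \<Longrightarrow> is_subring (\<Inter>C\<in>\<C>. g C)"
  by (simp add: is_subring_def)

lemma module_mult: "module ((*) :: 'a::comm_ring_1 \<Rightarrow> 'a \<Rightarrow> 'a)"
  by unfold_locales (simp_all add: algebra_simps)

definition frozen_inverse :: gen_poly where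
  "frozen_inverse = Poly_Mapping.single 0 (Poly_Mapping.single (- 1) 1)"

lemma frozen_inverse_mult: "frozen_inverse * frozen_const = 1"
  by (simp add: frozen_inverse_def frozen_const_def mult_single)

lemma range_gen: "range h = {h Gen_a, h Gen_b, h Gen_c, h Gen_d, h Gen_X, h Gen_Y, h Gen_Z}"
proof
  show "range h \<subseteq> {h Gen_a, h Gen_b, h Gen_c, h Gen_d, h Gen_X, h Gen_Y, h Gen_Z}"
  proof
    fix y assume "y \<in> range h"
    then obtain g where "y = h g" by blast
    then show "y \<in> {h Gen_a, h Gen_b, h Gen_c, h Gen_d, h Gen_X, h Gen_Y, h Gen_Z}" by (cases g) auto
  qed
qed auto

text \<open>Turns claims about all of \<open>gen_poly\<close> into an induction over nine
  generators, both for the image of the evaluation map and for the reduction modulo the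
  relations.\<close>

lemma gen_poly_generated: "subring_gen ({frozen_const, frozen_inverse} \<union> range gen_var) = UNIV"
proof -
  let ?G = "subring_gen ({frozen_const, frozen_inverse} \<union> range gen_var)"
  have pow: "Poly_Mapping.single 0 (Poly_Mapping.single (int n) 1) = frozen_const ^ n"
    "Poly_Mapping.single 0 (Poly_Mapping.single (- int n) 1) = frozen_inverse ^ n" for n
  proof (induction n)
    case (Suc n)
    {
      case 1
      show ?case unfolding power_Suc Suc(1)[symmetric] by (simp add: frozen_const_def mult_single)
    next
      case 2
      show ?case unfolding power_Suc Suc(2)[symmetric] by (simp add: frozen_inverse_def mult_single)
    }
  qed simp_all
  have laurent: "Poly_Mapping.single 0 p \<in> ?G" for p
  proof (induction p rule: poly_mapping_add_induct)
    case (single k c)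
    have "Poly_Mapping.single 0 (Poly_Mapping.single k c) = of_int c * Poly_Mapping.single 0 (Poly_Mapping.single k 1)"
      by (simp add: mult_single flip: single_of_int)
    moreover have "Poly_Mapping.single 0 (Poly_Mapping.single k 1) \<in> ?G"
      by (cases k rule: int_cases2) (auto simp: pow intro!: subring_gen_power intro: subring_gen.base)
    ultimately show ?case using subring_gen.mult[OF subring_gen_of_int] by metis
  qed (auto simp: single_add intro: subring_gen_zero subring_gen_add)
  have mon: "Poly_Mapping.single m 1 \<in> ?G" for m
  proof (induction m rule: poly_mapping_add_induct)
    case zero
    show ?case by (simp add: subring_gen.one)
  next
    case (single g n)
    have "Poly_Mapping.single (Poly_Mapping.single g n) 1 = gen_var g ^ n"
    proof (induction n)
      case (Suc n)
      show ?case unfolding power_Suc Suc[symmetric]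
        by (simp add: gen_var_def mult_single single_add[symmetric])
    qed simp
    then show ?case by (auto intro!: subring_gen_power intro: subring_gen.base)
  next
    case (add m n)
    have "(Poly_Mapping.single (m + n) 1 :: gen_poly) = Poly_Mapping.single m 1 * Poly_Mapping.single n 1"
      by (simp add: mult_single)
    then show ?case using add by (auto intro: subring_gen.mult)
  qed
  have "p \<in> ?G" for p
  proof (induction p rule: poly_mapping_add_induct)
    case (single m c)
    have "Poly_Mapping.single m c = Poly_Mapping.single 0 c * Poly_Mapping.single m 1" by (simp add: mult_single)
    then show ?case using laurent mon by (auto intro: subring_gen.mult)
  qed (auto intro: subring_gen_zero subring_gen_add)
  then show ?thesis by blast
qed

section \<open>Reduction modulo the relations\<close>

definition rel_cong :: "gen_poly \<Rightarrow> gen_poly \<Rightarrow> bool" where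
  "rel_cong p q \<longleftrightarrow> p - q \<in> ideal_gen gen_relations"

lemma rel_cong_refl: "rel_cong p p"
  using module.span_zero[OF module_mult] by (simp add: rel_cong_def)

lemma rel_cong_diff: "rel_cong p q \<Longrightarrow> rel_cong p' q' \<Longrightarrow> rel_cong (p - p') (q - q')"
  using module.span_diff[OF module_mult, of "p - q" gen_relations "p' - q'"] by (simp add: rel_cong_def algebra_simps)

lemma rel_cong_mult:
  assumes "rel_cong p q" "rel_cong p' q'"
  shows "rel_cong (p * p') (q * q')"
proof -
  have "p' * (p - q) + q * (p' - q') \<in> ideal_gen gen_relations"
    using assms unfolding rel_cong_def by (intro module.span_add[OF module_mult] module.span_scale[OF module_mult])
  then show ?thesis by (simp add: rel_cong_def algebra_simps)
qed

lemma rel_cong_power: "rel_cong p q \<Longrightarrow> rel_cong (p ^ n) (q ^ n)"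
  by (induction n) (auto intro: rel_cong_refl rel_cong_mult)

abbreviation "ga \<equiv> gen_var Gen_a"
abbreviation "gb \<equiv> gen_var Gen_b"
abbreviation "gc \<equiv> gen_var Gen_c"
abbreviation "gd \<equiv> gen_var Gen_d"
abbreviation "gX \<equiv> gen_var Gen_X"
abbreviation "gY \<equiv> gen_var Gen_Y"
abbreviation "gZ \<equiv> gen_var Gen_Z"

lemma relations_in_ideal:
  "gb * gc * gX - (gb\<^sup>2 + gc\<^sup>2 + ga * gd) \<in> ideal_gen gen_relations"
  "(gc * gY - gb * gZ) - (gd - ga) \<in> ideal_gen gen_relations"
  "(gb * gX * gZ - ga * gX - gb * gY - gc * gZ) - frozen_const \<in> ideal_gen gen_relations"
  by (auto intro!: module.span_base[OF module_mult] simp: gen_relations_def Let_def)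

lemma rel_cong_d: "rel_cong gd (ga + gc * gY - gb * gZ)"
  using module.span_neg[OF module_mult relations_in_ideal(2)] by (simp add: rel_cong_def algebra_simps)

lemma rel_cong_f: "rel_cong frozen_const (gb * gX * gZ - ga * gX - gb * gY - gc * gZ)"
  using module.span_neg[OF module_mult relations_in_ideal(3)] by (simp add: rel_cong_def algebra_simps)

text \<open>A power of the unit f clears its negative powers. Relation 5 then replaces f, and
  relation 2 replaces d, by polynomials in the other six symbols.\<close>

lemma rel_cong_reduce:
  fixes p :: gen_poly
  shows "\<exists>N. \<exists>q\<in>subring_gen {gX, ga, gb, gc, gY, gZ}. rel_cong (frozen_const ^ N * p) q"
proof -
  let ?A = "subring_gen {gX, ga, gb, gc, gY, gZ}"
  note A = is_subring_subring_gen[of "{gX, ga, gb, gc, gY, gZ}"]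
  define g where "g = gb * gX * gZ - ga * gX - gb * gY - gc * gZ"
  have gens: "gX \<in> ?A" "ga \<in> ?A" "gb \<in> ?A" "gc \<in> ?A" "gY \<in> ?A" "gZ \<in> ?A"
    by (auto intro: subring_gen.base)
  have gA: "g \<in> ?A" unfolding g_def by (intro is_subringD[OF A] gens)
  have dA: "ga + gc * gY - gb * gZ \<in> ?A" by (intro is_subringD[OF A] gens)
  have F: "rel_cong (frozen_const ^ N) (g ^ N)" for N
    using rel_cong_power[OF rel_cong_f] by (simp add: g_def)
  have "p \<in> subring_gen ({frozen_const, frozen_inverse} \<union> range gen_var)"
    unfolding gen_poly_generated by simp
  then show ?thesis
  proof induction
    case (base s)
    have "\<exists>N. \<exists>q\<in>?A. rel_cong (frozen_const ^ N * s) q" if "q \<in> ?A" "rel_cong (frozen_const ^ N * s) q" for N q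
      using that by blast
    note w = this
    have w0: "\<exists>N. \<exists>q\<in>?A. rel_cong (frozen_const ^ N * s) q" if "s \<in> ?A"
      using w[of s 0] that rel_cong_refl by simp
    from base have "s = frozen_const \<or> s = frozen_inverse \<or> s = gd \<or> s \<in> ?A"
      using gens unfolding range_gen[of gen_var] by blast
    then show ?case
    proof (elim disjE)
      assume "s = frozen_const"
      then show ?thesis using w[of g 0] gA F[of 1] by simp
    next
      assume "s = frozen_inverse"
      then show ?thesis using w[of 1 1] is_subringD(2)[OF A] frozen_inverse_mult rel_cong_refl
        by (simp add: mult.commute)
    next
      assume "s = gd"
      then show ?thesis using w[OF dA, of 0] rel_cong_d by simp
    qed (rule w0)
  next
    case one
    show ?case using subring_gen.one rel_cong_refl[of 1] by (intro exI[of _ 0] bexI[of _ 1]) auto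
  next
    case (diff u v)
    then obtain M q N r where *: "q \<in> ?A" "rel_cong (frozen_const ^ M * u) q" "r \<in> ?A" "rel_cong (frozen_const ^ N * v) r"
      by blast
    \<comment> \<open>Both terms on the left receive the same power of \<open>frozen_const\<close>;
      on the right its representative \<open>g\<close> is used, so that the result stays in
      \<open>?A\<close>.\<close>
    have "rel_cong (frozen_const ^ N * (frozen_const ^ M * u) - frozen_const ^ M * (frozen_const ^ N * v)) (g ^ N * q - g ^ M * r)"
      by (intro rel_cong_diff rel_cong_mult F *)
    moreover have "frozen_const ^ N * (frozen_const ^ M * u) - frozen_const ^ M * (frozen_const ^ N * v) = frozen_const ^ (M + N) * (u - v)"
      by (simp add: power_add algebra_simps)
    moreover have "g ^ N * q - g ^ M * r \<in> ?A" using * gA by (intro is_subringD[OF A] is_subring_power[OF A])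
    ultimately show ?case by metis
  next
    case (mult u v)
    then obtain M q N r where *: "q \<in> ?A" "rel_cong (frozen_const ^ M * u) q" "r \<in> ?A" "rel_cong (frozen_const ^ N * v) r"
      by blast
    have "rel_cong ((frozen_const ^ M * u) * (frozen_const ^ N * v)) (q * r)" by (intro rel_cong_mult *)
    moreover have "(frozen_const ^ M * u) * (frozen_const ^ N * v) = frozen_const ^ (M + N) * (u * v)"
      by (simp add: power_add mult_ac)
    moreover have "q * r \<in> ?A" using * by (intro is_subringD[OF A])
    ultimately show ?case by metis
  qed
qed

section \<open>The evaluation map, its image and its kernel\<close>

context cluster_tuple
begin

definition \<Phi> :: "gen_poly \<Rightarrow> 'a" where
  "\<Phi> = eval_mpoly (eval_laurent f) (case_gen a b c d X Y Z)"

lemma is_ring_hom_\<Phi>: "is_ring_hom \<Phi>"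
  unfolding \<Phi>_def using nonzero by (intro is_ring_hom_eval_mpoly is_ring_hom_eval_laurent)

lemma \<Phi>_gen_var: "\<Phi> (gen_var g) = case_gen a b c d X Y Z g"
  using nonzero is_ring_homD(2)[OF is_ring_hom_eval_laurent[of f]]
  by (simp add: \<Phi>_def gen_var_def eval_mpoly_eq_mon_eval mon_eval_single is_ring_hom_eval_laurent mpoly_mon_single)

lemma \<Phi>_frozen: "\<Phi> frozen_const = f" "\<Phi> frozen_inverse = inverse f"
  using nonzero
  by (simp_all add: \<Phi>_def frozen_const_def frozen_inverse_def eval_mpoly_eq_mon_eval mon_eval_single
      is_ring_hom_eval_laurent mpoly_mon_zero, simp_all add: eval_laurent_eq_mon_eval mon_eval_single is_ring_hom_of_int)

lemma range_\<Phi>: "range \<Phi> = R"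
proof -
  have "range \<Phi> = \<Phi> ` subring_gen ({frozen_const, frozen_inverse} \<union> range gen_var)"
    by (simp only: gen_poly_generated)
  also have "\<dots> = subring_gen (\<Phi> ` ({frozen_const, frozen_inverse} \<union> range gen_var))"
    by (rule ring_hom_image_subring_gen[OF is_ring_hom_\<Phi>])
  also have "\<Phi> ` ({frozen_const, frozen_inverse} \<union> range gen_var) = {f, inverse f, a, b, c, d, X, Y, Z}"
    unfolding range_gen[of gen_var] by (auto simp: \<Phi>_gen_var \<Phi>_frozen)
  finally show ?thesis by (simp add: R_def)
qed

lemma relations_vanish: "r \<in> gen_relations \<Longrightarrow> \<Phi> r = 0"
proof -
  note h = is_ring_homD[OF is_ring_hom_\<Phi>] is_ring_hom_power[OF is_ring_hom_\<Phi>] \<Phi>_gen_var \<Phi>_frozen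
  have e: "c * Y - b * Z = d - a" by (subst d_eq) simp
  have "\<Phi> (gb * gc * gX - (gb\<^sup>2 + gc\<^sup>2 + ga * gd)) = 0" by (simp add: h relX)
  moreover have "\<Phi> ((gc * gY - gb * gZ) - (gd - ga)) = 0" by (simp add: h e)
  moreover have "\<Phi> ((ga * gc * gX - ga * gd * gZ) - (ga * gb - gb * gd - gc * frozen_const)) = 0"
    by (simp add: h relZ)
  moreover have "\<Phi> ((gb * gd * gX - ga * gd * gY) - (gc * gd - ga * gc - gb * frozen_const)) = 0"
    by (simp add: h relY)
  moreover have "\<Phi> ((gb * gX * gZ - ga * gX - gb * gY - gc * gZ) - frozen_const) = 0"
    by (simp add: h f_eq[symmetric])
  ultimately show "r \<in> gen_relations \<Longrightarrow> \<Phi> r = 0"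
    unfolding gen_relations_def Let_def by blast
qed

lemma ideal_subset_kernel: "ideal_gen gen_relations \<subseteq> {p. \<Phi> p = 0}"
proof (rule module.span_minimal[OF module_mult])
  show "gen_relations \<subseteq> {p. \<Phi> p = 0}" using relations_vanish by blast
  show "module.subspace (*) {p. \<Phi> p = 0}"
    by (auto simp: module.subspace_def[OF module_mult] is_ring_homD[OF is_ring_hom_\<Phi>])
qed

text \<open>This is the coprimality of the two coefficients of the hypersurface equation, viewed as
  linear in \<open>X\<close>. Modulo \<open>b\<close> the right-hand element becomes a^2 + c^2 + a c
  Y, modulo \<open>c\<close> it becomes a^2 + b^2 - a b Z; these are nonzero, being linear in
  \<open>Y\<close> and in \<open>Z\<close>.\<close>

lemma prime_to_hypersurface:
  "prime_to (subring_gen {a, b, c, Y, Z}) (b * c) (a\<^sup>2 + b\<^sup>2 + c\<^sup>2 + a * c * Y - a * b * Z)"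
proof (rule prime_to_mult[OF is_subring_subring_gen])
  let ?D = "subring_gen {a, b, c, Y, Z}"
  have i: "alg_indep [b, a, c, Y, Z]" "alg_indep [Y, a, c, Z]" "alg_indep [c, a, b, Y, Z]" "alg_indep [Z, a, b, Y]"
    using alg_indep_mset[OF _ indep_abcYZ, of "[b, a, c, Y, Z]"] alg_indep_mset[OF _ indep_abcYZ, of "[b, Y, a, c, Z]"]
      alg_indep_mset[OF _ indep_abcYZ, of "[c, a, b, Y, Z]"] alg_indep_mset[OF _ indep_abcYZ, of "[c, Z, a, b, Y]"]
    by auto
  have gens: "a \<in> ?D" "b \<in> ?D" "c \<in> ?D" "Y \<in> ?D" "Z \<in> ?D" by (auto intro: subring_gen.base)
  note D = is_subringD[OF is_subring_subring_gen]
  show "b \<in> ?D" "c \<in> ?D" by (rule gens)+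
  show "a\<^sup>2 + b\<^sup>2 + c\<^sup>2 + a * c * Y - a * b * Z \<in> ?D" unfolding power2_eq_square by (intro D gens)
  show "z = 0" if "b * z = 0" for z using that nonzero by simp
  have "prime_to (adjoin (subring_gen {a, c, Y, Z}) b) b (a\<^sup>2 + b\<^sup>2 + c\<^sup>2 + a * c * Y - a * b * Z)"
  proof (rule prime_to_variable[OF is_subring_subring_gen, where ?n0.0 = "a * a + c * c + (a * c) * Y" and ?n1.0 = "b - a * Z"])
    show "transc (subring_gen {a, c, Y, Z}) b" using i(1) by simp
    have "a \<in> subring_gen {a, c, Y, Z}" "c \<in> subring_gen {a, c, Y, Z}" "Y \<in> subring_gen {a, c, Y, Z}"
      by (auto intro: subring_gen.base)
    then show "a * a + c * c + (a * c) * Y \<in> subring_gen {a, c, Y, Z}" by (intro subring_gen_add subring_gen.mult)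
    have "a \<in> subring_gen {a, c, Z}" "c \<in> subring_gen {a, c, Z}" by (auto intro: subring_gen.base)
    then show "a * a + c * c + (a * c) * Y \<noteq> 0"
      using i(2) nonzero by (intro transc_linear_nonzero[OF _ is_subring_subring_gen[of "{a, c, Z}"]] subring_gen_add subring_gen.mult) auto
    show "b - a * Z \<in> adjoin (subring_gen {a, c, Y, Z}) b"
      unfolding subring_gen_insert[symmetric] by (intro subring_gen.diff subring_gen.mult) (auto intro: subring_gen.base)
  qed (simp add: algebra_simps power2_eq_square)
  then show "prime_to ?D b (a\<^sup>2 + b\<^sup>2 + c\<^sup>2 + a * c * Y - a * b * Z)"
    by (simp add: subring_gen_insert[symmetric] insert_commute)
  have "prime_to (adjoin (subring_gen {a, b, Y, Z}) c) c (a\<^sup>2 + b\<^sup>2 + c\<^sup>2 + a * c * Y - a * b * Z)"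
  proof (rule prime_to_variable[OF is_subring_subring_gen, where ?n0.0 = "a * a + b * b + (- (a * b)) * Z" and ?n1.0 = "c + a * Y"])
    show "transc (subring_gen {a, b, Y, Z}) c" using i(3) by simp
    have "a \<in> subring_gen {a, b, Y, Z}" "b \<in> subring_gen {a, b, Y, Z}" "Z \<in> subring_gen {a, b, Y, Z}"
      by (auto intro: subring_gen.base)
    then show "a * a + b * b + (- (a * b)) * Z \<in> subring_gen {a, b, Y, Z}"
      by (intro subring_gen_add subring_gen.mult subring_gen_uminus)
    have "a \<in> subring_gen {a, b, Y}" "b \<in> subring_gen {a, b, Y}" by (auto intro: subring_gen.base)
    then show "a * a + b * b + (- (a * b)) * Z \<noteq> 0"
      using i(4) nonzero by (intro transc_linear_nonzero[OF _ is_subring_subring_gen[of "{a, b, Y}"]]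
          subring_gen_add subring_gen.mult subring_gen_uminus) auto
    show "c + a * Y \<in> adjoin (subring_gen {a, b, Y, Z}) c"
      unfolding subring_gen_insert[symmetric] by (intro subring_gen_add subring_gen.mult) (auto intro: subring_gen.base)
  qed (simp add: algebra_simps power2_eq_square)
  then show "prime_to ?D c (a\<^sup>2 + b\<^sup>2 + c\<^sup>2 + a * c * Y - a * b * Z)"
    by (simp add: subring_gen_insert[symmetric] insert_commute)
qed

text \<open>\<open>q\<close> is a polynomial in \<open>gX\<close> over the other five symbols, on
  whose ring \<open>\<Phi>\<close> is injective. After evaluation it has the root X = \<Phi> n /
  \<Phi> m, so Gauss's lemma splits off the factor \<open>m * gX - n\<close>, which lies in the
  ideal.\<close>

lemma kernel_reduced:
  assumes q: "q \<in> subring_gen {gX, ga, gb, gc, gY, gZ}" "\<Phi> q = 0"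
  shows "q \<in> ideal_gen gen_relations"
proof -
  let ?xs = "[ga, gb, gc, gY, gZ]"
  let ?D = "subring_gen (set ?xs)"
  note h = is_ring_homD[OF is_ring_hom_\<Phi>] is_ring_hom_power[OF is_ring_hom_\<Phi>]
  note D = is_subring_subring_gen[of "set ?xs"]
  have "alg_indep (map \<Phi> ?xs)"
    using alg_indep_mset[OF _ indep_abcYZ, of "[a, b, c, Y, Z]"] by (simp add: \<Phi>_gen_var)
  then have inj: "\<Phi> p = 0 \<longleftrightarrow> p = 0" if "p \<in> ?D" for p
    using ring_hom_eq_0_iff_alg_indep[OF is_ring_hom_\<Phi> _ that] by simp
  have img: "\<Phi> ` ?D = subring_gen {a, b, c, Y, Z}"
    by (simp add: ring_hom_image_subring_gen[OF is_ring_hom_\<Phi>] \<Phi>_gen_var)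
  define m n where "m = gb * gc" and "n = ga\<^sup>2 + gb\<^sup>2 + gc\<^sup>2 + ga * gc * gY - ga * gb * gZ"
  have gens: "ga \<in> ?D" "gb \<in> ?D" "gc \<in> ?D" "gY \<in> ?D" "gZ \<in> ?D" by (auto intro: subring_gen.base)
  have mD: "m \<in> ?D" and nD: "n \<in> ?D"
    unfolding m_def n_def power2_eq_square by (intro is_subringD[OF D] gens)+
  have \<Phi>m: "\<Phi> m = b * c" and \<Phi>n: "\<Phi> n = a\<^sup>2 + b\<^sup>2 + c\<^sup>2 + a * c * Y - a * b * Z"
    by (simp_all add: m_def n_def h \<Phi>_gen_var)
  have \<Phi>nm: "\<Phi> n = \<Phi> m * X" using relX' by (simp add: \<Phi>m \<Phi>n)
  obtain P where P: "P \<in> poly_over ?D" "q = poly P gX"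
    using q(1) subring_gen_insert[of gX "set ?xs"] by (auto simp: adjoin_def)
  have "\<exists>Q\<in>poly_over ?D. P = [:- n, m:] * Q"
  proof (rule linear_factor_over[OF D mD nD _ _ P(1) order_refl])
    show "z = 0" if z: "z \<in> ?D" "m * z = 0" for z
    proof -
      have "\<Phi> m * \<Phi> z = 0" using z(2) h by metis
      then show ?thesis using inj[OF z(1)] nonzero by (simp add: \<Phi>m)
    qed
    \<comment> \<open>Holds for the values by \<open>prime_to_hypersurface\<close> and is pulled
      back along the injective \<open>\<Phi>\<close>.\<close>
    show "prime_to ?D m n"
      unfolding prime_to_def
    proof (intro ballI impI)
      fix y z assume yz: "y \<in> ?D" "z \<in> ?D" "m * y = n * z"
      have "\<Phi> m * \<Phi> y = \<Phi> n * \<Phi> z" using yz(3) h by metis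
      moreover have "\<Phi> y \<in> \<Phi> ` ?D" "\<Phi> z \<in> \<Phi> ` ?D" using yz by auto
      ultimately have "\<exists>z'\<in>\<Phi> ` ?D. \<Phi> z = \<Phi> m * z'"
        using prime_to_hypersurface unfolding img \<Phi>m \<Phi>n prime_to_def by blast
      then obtain z' where z': "z' \<in> ?D" "\<Phi> z = \<Phi> m * \<Phi> z'" by blast
      then have "\<Phi> (z - m * z') = 0" by (simp add: h)
      moreover have "z - m * z' \<in> ?D" using yz(2) z'(1) mD by (intro is_subringD[OF D])
      ultimately show "\<exists>z'\<in>?D. z = m * z'" using inj z'(1) by auto
    qed
    define s where "s = (\<Sum>i\<le>degree P. coeff P i * n ^ i * m ^ (degree P - i))"
    have sD: "s \<in> ?D"
      unfolding s_def by (intro is_subring_sum is_subring_power is_subringD(4) poly_overD[OF P(1)] D mD nD)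
    have hsum: "\<Phi> (sum g I) = (\<Sum>i\<in>I. \<Phi> (g i))" for g :: "nat \<Rightarrow> gen_poly" and I
      by (induction I rule: infinite_finite_induct) (simp_all add: h)
    \<comment> \<open>Since \<open>\<Phi> n = \<Phi> m * X\<close>, homogenising only multiplies the
      value at \<open>X\<close> by \<open>\<Phi> m ^ degree P\<close>; so \<open>s\<close> is mapped
      to a multiple of \<open>\<Phi> q\<close>, which is zero.\<close>
    have "\<Phi> s = (\<Sum>i\<le>degree P. \<Phi> m ^ degree P * (\<Phi> (coeff P i) * X ^ i))"
      unfolding s_def hsum
    proof (rule sum.cong[OF refl])
      fix i assume i: "i \<in> {..degree P}"
      have "\<Phi> m ^ degree P = \<Phi> m ^ i * \<Phi> m ^ (degree P - i)" using i by (simp flip: power_add)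
      then show "\<Phi> (coeff P i * n ^ i * m ^ (degree P - i)) = \<Phi> m ^ degree P * (\<Phi> (coeff P i) * X ^ i)"
        by (simp add: h \<Phi>nm power_mult_distrib mult_ac)
    qed
    also have "\<dots> = \<Phi> m ^ degree P * \<Phi> q"
      unfolding P(2) poly_altdef hsum sum_distrib_left by (simp add: h \<Phi>_gen_var)
    finally show "s = 0" using q(2) inj[OF sD] by simp
  qed
  then obtain Q where Q: "P = [:- n, m:] * Q" by blast
  \<comment> \<open>Relation 1 minus \<open>ga\<close> times relation 2, which eliminates
    \<open>gd\<close>.\<close>
  have "m * gX - n = (gb * gc * gX - (gb\<^sup>2 + gc\<^sup>2 + ga * gd)) - ga * ((gc * gY - gb * gZ) - (gd - ga))"
    by (simp add: m_def n_def algebra_simps power2_eq_square)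
  moreover have "\<dots> \<in> ideal_gen gen_relations"
    by (intro module.span_diff[OF module_mult] module.span_scale[OF module_mult] relations_in_ideal)
  ultimately have "m * gX - n \<in> ideal_gen gen_relations" by (simp only:)
  then have "poly Q gX * (m * gX - n) \<in> ideal_gen gen_relations" by (rule module.span_scale[OF module_mult])
  moreover have "q = poly Q gX * (m * gX - n)" by (simp add: P(2) Q algebra_simps)
  ultimately show ?thesis by simp
qed

lemma kernel_eq_ideal: "{p. \<Phi> p = 0} = ideal_gen gen_relations"
proof
  show "{p. \<Phi> p = 0} \<subseteq> ideal_gen gen_relations"
  proof
    fix p assume "p \<in> {p. \<Phi> p = 0}"
    then have p: "\<Phi> p = 0" by simp
    obtain N q where q: "q \<in> subring_gen {gX, ga, gb, gc, gY, gZ}" "rel_cong (frozen_const ^ N * p) q"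
      using rel_cong_reduce by blast
    have "\<Phi> (frozen_const ^ N * p - q) = 0" using q(2) ideal_subset_kernel by (auto simp: rel_cong_def)
    then have "\<Phi> q = 0" using p by (simp add: is_ring_homD[OF is_ring_hom_\<Phi>])
    then have "q \<in> ideal_gen gen_relations" using q(1) by (intro kernel_reduced)
    then have "frozen_const ^ N * p - q + q \<in> ideal_gen gen_relations"
      using q(2) unfolding rel_cong_def by (intro module.span_add[OF module_mult])
    \<comment> \<open>f is a unit of \<open>gen_poly\<close>, so the power introduced by
      \<open>rel_cong_reduce\<close> can be removed without leaving the ideal.\<close>
    then have "frozen_inverse ^ N * (frozen_const ^ N * p) \<in> ideal_gen gen_relations"
      by (intro module.span_scale[OF module_mult, of "frozen_const ^ N * p"]) simp
    moreover have "frozen_inverse ^ N * (frozen_const ^ N * p) = p"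
      by (simp add: mult.assoc[symmetric] power_mult_distrib[symmetric] frozen_inverse_mult)
    ultimately show "p \<in> ideal_gen gen_relations" by simp
  qed
qed (rule ideal_subset_kernel)

lemma R_eq_subring_gen_laurent: "R = subring_gen (laurent_ring {f} \<union> {a, b, c, d, X, Y, Z})"
proof
  show "R \<subseteq> subring_gen (laurent_ring {f} \<union> {a, b, c, d, X, Y, Z})"
    unfolding R_def
    by (intro subring_gen_mono) (auto simp: laurent_ring_def intro: subring_gen.base)
  have "laurent_ring {f} \<subseteq> R"
    unfolding laurent_ring_def using gens_in_R by (intro subring_gen_minimal is_subring_R) auto
  then show "subring_gen (laurent_ring {f} \<union> {a, b, c, d, X, Y, Z}) \<subseteq> R"
    using gens_in_R by (intro subring_gen_minimal is_subring_R) auto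
qed

lemma upper_cluster_algebra_eq_R:
  assumes B: "B = exchange_matrix"
  shows "upper_cluster_algebra 5 4 ((!) [a, b, c, d, f], B) = R"
proof -
  define x where "x = (!) [a, b, c, d, f]"
  let ?s = "(x, B)"
  let ?U = "upper_cluster_algebra 5 4 ?s"
  have x: "x 0 = a" "x 1 = b" "x 2 = c" "x 3 = d" "x 4 = f" by (simp_all add: x_def)
  have "permute_seed id ?s = ?s" by (simp add: permute_seed_def)
  moreover have "canonical_seed R ?s" unfolding canonical_seed_def using cluster_tuple_axioms x B by auto
  moreover have "index_perm id" by (simp add: index_perm_def permutes_id)
  ultimately have good: "good_seed R ?s" unfolding good_seed_def by metis
  have RU: "R \<subseteq> ?U"
    unfolding upper_cluster_algebra_def clusters_def
    using good_seed_subset_laurent[OF good_seed_mutation_equivalent[OF _ good]] by blast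
  have U: "?U \<subseteq> laurent_ring (fst t ` {..<5})" if "mutation_equivalent 5 4 ?s t" for t
    unfolding upper_cluster_algebra_def clusters_def using that by blast
  have mut: "mutation_equivalent 5 4 ?s (mutate 5 k ?s)" if "k < 4" for k
    unfolding mutation_equivalent_def using that by (intro r_into_equivclp) (auto simp: seed_step_def)
  have B': "\<forall>i<5. \<forall>j<4. B i j = exchange_matrix i j" by (simp add: B)
  have M: "?U \<subseteq> laurent_ring C" if "k < 4" "fst (mutate 5 k ?s) ` {..<5} = C" for k C
    using U[OF mut[OF that(1)]] unfolding that(2) .
  have "is_subring ?U"
    unfolding upper_cluster_algebra_def by (intro is_subring_INT is_subring_laurent_ring)
  then have "?U \<subseteq> R"
  proof (rule subset_R[OF _ _ RU])
    show "?U \<subseteq> laurent_ring {a, b, c, d, f}"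
      using U[of ?s] x by (simp add: mutation_equivalent_def lessThan_5)
    show "?U \<subseteq> laurent_ring {(b * d + c * f) / a, b, c, d, f}"
      by (rule M[of 0]) (use x in \<open>auto simp: lessThan_5 fst_mutate_canonical[OF B', simplified]\<close>)
    show "?U \<subseteq> laurent_ring {a, (c\<^sup>2 + a * d) / b, c, d, f}"
      by (rule M[of 1]) (use x in \<open>auto simp: lessThan_5 fst_mutate_canonical[OF B', simplified]\<close>)
    show "?U \<subseteq> laurent_ring {d, (b\<^sup>2 + d * a) / c, b, a, f}"
      by (rule M[of 2]) (use x in \<open>auto simp: lessThan_5 fst_mutate_canonical[OF B', simplified]\<close>)
    show "?U \<subseteq> laurent_ring {(c * a + b * f) / d, c, b, a, f}"
      by (rule M[of 3]) (use x in \<open>auto simp: lessThan_5 fst_mutate_canonical[OF B', simplified]\<close>)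
  qed
  with RU show ?thesis by (auto simp: x_def)
qed

end

theorem proposition7p2p1:
  fixes a b c d f X Y Z :: "'a::field_char_0"
    and B :: "nat \<Rightarrow> nat \<Rightarrow> int"
    and U :: "'a set"
    and \<phi> :: "gen_poly \<Rightarrow> 'a"
  assumes B: "B = (\<lambda>i j. [[ 0, -1,  1, -1],
                          [ 1,  0, -2,  1],
                          [-1,  2,  0, -1],
                          [ 1, -1,  1,  0],
                          [-1,  0,  0,  1]] ! i ! j)"
    and seed: "is_seed 5 4 ((!) [a, b, c, d, f], B)"
    and U: "U = upper_cluster_algebra 5 4 ((!) [a, b, c, d, f], B)"
    and X: "X = (b\<^sup>2 + c\<^sup>2 + a * d) / (b * c)"
    and Y: "Y = (a * d\<^sup>2 + a * c\<^sup>2 + b * c * f + b\<^sup>2 * d) / (a * c * d)"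
    and Z: "Z = (a\<^sup>2 * d + a * c\<^sup>2 + b * c * f + b\<^sup>2 * d) / (a * b * d)"
    and \<phi>: "\<phi> = eval_mpoly (eval_laurent f) (case_gen a b c d X Y Z)"
  shows "U = subring_gen (laurent_ring {f} \<union> {a, b, c, d, X, Y, Z})
       \<and> range \<phi> = U
       \<and> {p. \<phi> p = 0} = ideal_gen gen_relations"
proof -
  have "freely_generates 5 ((!) [a, b, c, d, f])" using seed by (simp add: is_seed_def)
  then have "alg_indep (map ((!) [a, b, c, d, f]) (rev [0..<5]))"
    by (rule freely_generates_alg_indep) simp
  moreover have "map ((!) [a, b, c, d, f]) (rev [0..<5]) = [f, d, c, b, a]"
    by (simp add: upt_rec)
  ultimately have "alg_indep [f, d, c, b, a]" by simp
  then have "alg_indep [a, b, c, d, f]" by (rule alg_indep_mset[rotated]) simp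
  then interpret cluster_tuple a b c d f X Y Z using X Y Z by (rule cluster_tuple.intro)
  have "U = R" unfolding U by (rule upper_cluster_algebra_eq_R) (simp only: B exchange_matrix_def)
  moreover have "\<phi> = \<Phi>" by (simp add: \<phi> \<Phi>_def)
  ultimately show ?thesis using R_eq_subring_gen_laurent range_\<Phi> kernel_eq_ideal by simp
qed



end
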